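(* Let $k,L$ be positive integers with $1<k\le L$, and let $T\in V_L^*$ be constructed with the sequence $(r_n)$. Then the $k$-fold Cartesian product $T\times\cdots\times T$ ($k$ factors) is ergodic with respect to $\mu^k$ if and only if $\sum_{i=1}^\infty (1/r_i)^k=\infty$.
   Context: Let $L\ge1$ and $V_L=\{(u_1,\dots,u_L)\in\mathbb N^L: u_1<u_2<\dots<u_L\}$. Fix an enumeration $V_L=\{v_j:j\in\mathbb N\}$ and define $s:\mathbb N\to V_L$ by $s(2^{j-1}+i2^j)=v_j$ for $j\ge1$, $i\ge0$. Let $(r_n)$ be a nondecreasing sequence of positive integers with $r_n>L$. Start with the column $C_1=[0,1)$ (height $h_1=1$). Given the column $C_n$ of height $h_n$ (a stack of intervals of equal length, each level mapped to the one above by translation), write $s(n)=(u_1,\dots,u_L)$ and $\sigma=u_1+\dots+u_L$. Cut $C_n$ into $r_n$ subcolumns of equal width numbered $1,\dots,r_n$ from left to right; place $(2L+1)h_n+\sigma$ spacers on top of subcolumn $i$ for $1\le i\le r_n-L-1$, and $h_n+u_d$ spacers on top of subcolumn $r_n-L-1+d$ for $1\le d\le L$; stack each subcolumn (with its spacers) on top of the subcolumn to its left, forming a column of height $g_n=r_nh_n+(r_n-L-1)((2L+1)h_n+\sigma)+(Lh_n+\sigma)$; finally place $g_n$ further spacers on top to obtain $C_{n+1}$ of height $h_{n+1}=2g_n$. The limit defines a transformation $T$ preserving Lebesgue measure $\mu$ on $X=\bigcup_n C_n$ (an infinite measure). $V_L^*$ denotes the family of all transformations obtained this way. $\mu^k$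 is the $k$-fold product measure. *)

theory Defs
  imports "HOL-Analysis.Analysis"
begin

definition VL :: "nat \<Rightarrow> nat list set" where
  "VL L = {us. length us = L \<and> sorted_wrt (<) us \<and> (\<forall>u\<in>set us. 1 \<le> u)}"

definition val2 :: "nat \<Rightarrow> nat" where
  "val2 n = (THE e. 2 ^ e dvd n \<and> \<not> 2 ^ (Suc e) dvd n)"

text \<open>s(2^(j-1) + i 2^j) = v_j, i.e. s n = v (val2 n + 1) for n >= 1.\<close>
definition sseq :: "(nat \<Rightarrow> nat list) \<Rightarrow> nat \<Rightarrow> nat list" where
  "sseq v n = v (val2 n + 1)"

text \<open>Number of spacers put on top of subcolumn i (1 <= i <= rr) of a column of height h.\<close>
definition spc :: "nat \<Rightarrow> nat \<Rightarrow> nat list \<Rightarrow> nat \<Rightarrow> nat" where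
  "spc h rr us i =
    (let L = length us; \<sigma> = sum_list us in
     if 1 \<le> i \<and> i \<le> rr - L - 1 then (2 * L + 1) * h + \<sigma>
     else if rr - L - 1 < i \<and> i \<le> rr - 1 then h + us ! (i - (rr - L - 1) - 1)
     else 0)"

text \<open>A column is (list of left endpoints of its levels, bottom to top; common width; F),
  where [0,F) is the part of [0,\<infinity>) used so far. New spacers are taken consecutively
  from [F,\<infinity>).\<close>
definition step :: "real list \<times> real \<times> real \<Rightarrow> nat \<Rightarrow> nat list \<Rightarrow> real list \<times> real \<times> real" where
  "step st rr us =
    (case st of (a, w, F) \<Rightarrow>
      (let h = length a;
           w' = w / real rr;
           S = (\<lambda>i. \<Sum>j\<in>{1..<i}. spc h rr us j);
           sp = (\<lambda>i. map (\<lambda>m. F + w' * real (S i + m)) [0..<spc h rr us i]);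
           stack = concat (map (\<lambda>i. map (\<lambda>x. x + real (i - 1) * w') a @ sp i) [1..<rr + 1]);
           g = length stack;
           top = map (\<lambda>m. F + w' * real (S (rr + 1) + m)) [0..<g]
       in (stack @ top, w', F + w' * real (S (rr + 1) + g))))"

text \<open>cols r v m is the column C_(m+1).\<close>
primrec cols :: "(nat \<Rightarrow> nat) \<Rightarrow> (nat \<Rightarrow> nat list) \<Rightarrow> nat \<Rightarrow> real list \<times> real \<times> real" where
  "cols r v 0 = ([0], 1, 1)"
| "cols r v (Suc m) = step (cols r v m) (r (Suc m)) (sseq v (Suc m))"

definition lev :: "(nat \<Rightarrow> nat) \<Rightarrow> (nat \<Rightarrow> nat list) \<Rightarrow> nat \<Rightarrow> real list" where
  "lev r v m = fst (cols r v m)"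

definition wid :: "(nat \<Rightarrow> nat) \<Rightarrow> (nat \<Rightarrow> nat list) \<Rightarrow> nat \<Rightarrow> real" where
  "wid r v m = fst (snd (cols r v m))"

definition rk_space :: "(nat \<Rightarrow> nat) \<Rightarrow> (nat \<Rightarrow> nat list) \<Rightarrow> real set" where
  "rk_space r v = (\<Union>m. \<Union>a\<in>set (lev r v m). {a..<a + wid r v m})"

definition rk_map :: "(nat \<Rightarrow> nat) \<Rightarrow> (nat \<Rightarrow> nat list) \<Rightarrow> real \<Rightarrow> real" where
  "rk_map r v x =
    (if \<exists>m j. Suc j < length (lev r v m) \<and> x \<in> {lev r v m ! j ..< lev r v m ! j + wid r v m}
     then (let (m, j) = (SOME (m, j). Suc j < length (lev r v m) \<and>
                           x \<in> {lev r v m ! j ..< lev r v m ! j + wid r v m})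
           in x + (lev r v m ! Suc j - lev r v m ! j))
     else x)"

definition rk_measure :: "(nat \<Rightarrow> nat) \<Rightarrow> (nat \<Rightarrow> nat list) \<Rightarrow> real measure" where
  "rk_measure r v = restrict_space lebesgue (rk_space r v)"

definition prod_map :: "nat \<Rightarrow> ('a \<Rightarrow> 'a) \<Rightarrow> (nat \<Rightarrow> 'a) \<Rightarrow> (nat \<Rightarrow> 'a)" where
  "prod_map k T x = (\<lambda>i\<in>{..<k}. T (x i))"

definition ergodic :: "'a measure \<Rightarrow> ('a \<Rightarrow> 'a) \<Rightarrow> bool" where
  "ergodic M T \<longleftrightarrow> T \<in> M \<rightarrow>\<^sub>M M \<and>
     (\<forall>A\<in>sets M. T -` A \<inter> space M = A \<longrightarrow> emeasure M A = 0 \<or> emeasure M (space M - A) = 0)"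

end

theory Submission
  imports Defs
begin

text \<open>
  Write \<open>P\<close> for the product measure, and record a k-tuple of points of the n-th column by the
  vector of levels it occupies, so that the n-th column decomposes \<open>X^k\<close> into cubes.  A power of
  \<open>T \<times> \<dots> \<times> T\<close> translates a vector by a constant; cutting and stacking adds the heights of the
  subcolumns that are chosen.

  If the series diverges, let \<open>A\<close> be invariant and let \<open>D e\<close> be the supremum, over all columns and
  all pairs of cubes whose vectors differ by \<open>e\<close> up to a constant, of the differences of the relative
  densities of \<open>A\<close>.  Since \<open>k \<le> L\<close>, some tuple in \<open>V_L\<close> contains the entries of \<open>e\<close> up to a
  constant.  At each of its stages, of the four subcubes given by two suitable digit vectors, two
  lie on the same orbit and the other two differ by \<open>2 e\<close>; as these stages have divergent total
  probability, \<open>D e \<le> D (2 e) / 2\<close>.  Hence \<open>D = 0\<close>, so \<open>P\<close> restricted to \<open>A\<close> is a multiple of \<open>P\<close>.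

  If the series converges, a positive proportion of the points of a cube never has all k
  coordinates among the last L + 1 subcolumns simultaneously.  For such points the heights are too
  far apart for two different height differences to be compensated by earlier stages, so that the
  orbit of such a point only meets cubes with the same vector up to a constant.  The orbits
  of two cubes whose vectors do not differ by a constant are then disjoint up to the discarded points.
\<close>

section \<open>Preliminaries on lists, 2-adic valuations and products\<close>

lemma length_concat_map_upt: "length (concat (map f [0..<n])) = (\<Sum>j<n. length (f j))"
  by (induction n) auto

lemma nth_concat_map_upt:
  assumes "i < n" "q < length (f i)"
  shows "concat (map f [0..<n]) ! ((\<Sum>j<i. length (f j)) + q) = f i ! q"
  using assms
proof (induction n)
  case (Suc n)
  show ?case
  proof (cases "i < n")
    case True
    have "(\<Sum>j<i. length (f j)) + q < (\<Sum>j<Suc i. length (f j))"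
      using Suc.prems by simp
    also have "\<dots> \<le> (\<Sum>j<n. length (f j))"
      by (rule sum_mono2) (use True in auto)
    finally show ?thesis
      using Suc True by (simp add: nth_append length_concat_map_upt)
  next
    case False
    then have "i = n" using Suc.prems by simp
    then show ?thesis using Suc.prems
      by (auto simp: nth_append length_concat_map_upt)
  qed
qed simp

lemma sum_list_take_Suc:
  "d < length us \<Longrightarrow> sum_list (take (Suc d) us) = sum_list (take d us) + us ! d"
  for us :: "nat list"
  by (simp add: take_Suc_conv_app_nth)

lemma val2_eqI:
  assumes "2 ^ e dvd n" "\<not> 2 ^ Suc e dvd n"
  shows "val2 n = e"
  unfolding val2_def
proof (rule the_equality)
  fix f assume f: "2 ^ f dvd n \<and> \<not> 2 ^ Suc f dvd n"
  have "\<not> e < f" "\<not> f < e"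
    using f assms by (meson Suc_leI dvd_trans le_imp_power_dvd)+
  then show "f = e" by simp
qed (use assms in blast)

text \<open>The values of \<open>e\<close>, shifted to be positive, form a set of at most k \<le> L
  elements; enlarging it to \<open>L\<close> positive numbers and sorting gives the tuple. Repeated
  values of \<open>e\<close> do no harm, since \<open>d\<close> may repeat.\<close>

lemma ex_strict_list_containing:
  fixes e :: "nat \<Rightarrow> int"
  assumes "k \<le> L"
  obtains us d z where "us \<in> VL L" "\<And>c. c < k \<Longrightarrow> d c < L \<and> int (us ! d c) = e c + z"
proof -
  \<comment> \<open>The sum of absolute values dominates every single \<open>- e c\<close>, so the
    shifted entries are at least 1, as \<open>VL\<close> demands.\<close>
  define z where "z = 1 + (\<Sum>c<k. \<bar>e c\<bar>)"
  have pos: "1 \<le> e c + z" if "c < k" for c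
    using member_le_sum[of c "{..<k}" "\<lambda>c. \<bar>e c\<bar>"] that by (simp add: z_def)
  define S where "S = (\<lambda>c. nat (e c + z)) ` {..<k}"
  have S: "finite S" "card S \<le> L"
    using card_image_le[of "{..<k}" "\<lambda>c. nat (e c + z)"] assms by (auto simp: S_def)
  \<comment> \<open>The summand \<open>L\<close> leaves at least \<open>L\<close> candidates for the
    enlarged set; inserting 0 gives \<open>Max\<close> a value if \<open>S\<close> is empty.\<close>
  have "S \<subseteq> {1..L + Max (insert 0 S)}"
  proof
    fix x assume "x \<in> S"
    moreover from this have "x \<le> Max (insert 0 S)" using S by (intro Max_ge) auto
    moreover have "1 \<le> x" using \<open>x \<in> S\<close> pos by (force simp: S_def)
    ultimately show "x \<in> {1..L + Max (insert 0 S)}" by simp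
  qed
  then obtain B where B: "S \<subseteq> B" "B \<subseteq> {1..L + Max (insert 0 S)}" "card B = L"
    using exists_subset_between[of S L "{1..L + Max (insert 0 S)}"] S by auto
  have "finite B" using B by (meson finite_atLeastAtMost finite_subset)
  define us where "us = sorted_list_of_set B"
  have us: "set us = B" "length us = L" "sorted_wrt (<) us"
    using B \<open>finite B\<close> by (auto simp: us_def)
  have "\<exists>i<L. int (us ! i) = e c + z" if "c < k" for c
  proof -
    have "nat (e c + z) \<in> set us" using us B that by (auto simp: S_def)
    then obtain i where "i < L" "us ! i = nat (e c + z)" using us by (auto simp: in_set_conv_nth)
    then show ?thesis using pos[OF that] by auto
  qed
  then obtain d where "\<And>c. c < k \<Longrightarrow> d c < L \<and> int (us ! d c) = e c + z" by metis
  moreover have "us \<in> VL L" using us B by (auto simp: VL_def)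
  ultimately show thesis using that by blast
qed

lemma prod_one_minus_le_exp:
  fixes x :: "'a \<Rightarrow> real"
  assumes "\<And>j. j \<in> S \<Longrightarrow> x j \<le> 1"
  shows "(\<Prod>j\<in>S. 1 - x j) \<le> exp (- (\<Sum>j\<in>S. x j))"
proof (cases "finite S")
  case True
  have "(\<Prod>j\<in>S. 1 - x j) \<le> (\<Prod>j\<in>S. exp (- x j))"
    using assms exp_ge_add_one_self[of "- x _"] by (intro prod_mono) (auto simp: algebra_simps)
  then show ?thesis using True by (simp add: exp_sum sum_negf[symmetric])
qed simp

section \<open>Columns and their levels\<close>

locale rank_one_tower =
  fixes k L :: nat and r :: "nat \<Rightarrow> nat" and v :: "nat \<Rightarrow> nat list"
  assumes k_gt_1: "1 < k" and k_le_L: "k \<le> L"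
    and bij_v: "bij_betw v {1..} (VL L)"
    and r_Suc_ge: "\<forall>n\<ge>1. r n \<le> r (Suc n)"
    and r_gt_L: "\<forall>n\<ge>1. L < r n"
begin

text \<open>Indices are shifted by one: column \<open>m\<close> is C_(m+1), so \<open>R m\<close>
  and \<open>U m\<close> are the number of cuts and the tuple applied to it, and a series over
  \<open>R i\<close> with i \<ge> 0 is the series over r_i with i \<ge> 1.\<close>

definition "h m = length (lev r v m)"
abbreviation "w \<equiv> wid r v"
abbreviation "X \<equiv> rk_space r v"
abbreviation "T \<equiv> rk_map r v"
definition "R m = r (Suc m)"
definition "U m = sseq v (Suc m)"
text \<open>Subcolumns are numbered from 0 here, in contrast to \<^const>\<open>spc\<close>; the last L + 1 ones are
  b, \<dots>, b + L, and H is the height of the bottom of a subcolumn in the next column.\<close>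
definition "b m = R m - L - 1"
definition "H m i = (\<Sum>j<i. h m + spc (h m) (R m) (U m) (Suc j))"
definition "Level m j = {lev r v m ! j ..< lev r v m ! j + w m}"

lemma R_gt: "L < R m"
  using r_gt_L by (simp add: R_def)

lemma R_ge_2: "2 \<le> R m"
  using R_gt[of m] k_gt_1 k_le_L by simp

lemma R_eq: "R m = b m + L + 1"
  using R_gt[of m] by (simp add: b_def)

lemma U_in_VL: "U m \<in> VL L"
  using bij_betwE[OF bij_v] by (simp add: U_def sseq_def)

lemma length_U [simp]: "length (U m) = L"
  using U_in_VL[of m] by (simp add: VL_def)

text \<open>Unfolds \<open>step\<close> once and for all. With subcolumns counted from 0 the stack
  is a concatenation of length \<open>H m (R m)\<close>, which is the g of the construction.\<close>

lemma cols_Suc_components: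
  fixes m
  defines "a \<equiv> lev r v m" and "F \<equiv> snd (snd (cols r v m))" and "w' \<equiv> w m / real (R m)"
    and "S \<equiv> \<lambda>i. \<Sum>j<i. spc (h m) (R m) (U m) (Suc j)"
  defines "sub \<equiv> \<lambda>i. map (\<lambda>x. x + real i * w') a @
      map (\<lambda>q. F + w' * real (S i + q)) [0..<spc (h m) (R m) (U m) (Suc i)]"
  shows "lev r v (Suc m) = concat (map sub [0..<R m]) @
      map (\<lambda>q. F + w' * real (S (R m) + q)) [0..<H m (R m)]"
    and "w (Suc m) = w'"
    and "snd (snd (cols r v (Suc m))) = F + w' * real (S (R m) + H m (R m))"
    and "\<And>i. length (sub i) = h m + spc (h m) (R m) (U m) (Suc i)"
proof -
  let ?sp = "\<lambda>i. map (\<lambda>m'. F + w' * real ((\<Sum>j\<in>{1..<i}. spc (h m) (R m) (U m) j) + m'))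
      [0..<spc (h m) (R m) (U m) i]"
  let ?stack = "concat (map (\<lambda>i. map (\<lambda>x. x + real (i - 1) * w') a @ ?sp i) [1..<R m + 1])"
  have S: "(\<Sum>j\<in>{1..<Suc i}. spc (h m) (R m) (U m) j) = S i" for i
    unfolding S_def by (rule sum.reindex_bij_witness[of _ Suc "\<lambda>j. j - 1"]) auto
  have upt: "[1..<R m + 1] = map Suc [0..<R m]"
    by (simp add: map_Suc_upt)
  have stack: "?stack = concat (map sub [0..<R m])"
    unfolding upt map_map comp_def S sub_def by simp
  show len: "length (sub i) = h m + spc (h m) (R m) (U m) (Suc i)" for i
    by (simp add: sub_def a_def h_def)
  have g: "length ?stack = H m (R m)"
    unfolding stack length_concat_map_upt by (simp add: len H_def)
  obtain a0 w0 F0 where c: "cols r v m = (a0, w0, F0)"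
    by (cases "cols r v m") auto
  have c': "a0 = a" "F0 = F" "w0 = w m" "length a = h m"
    using c by (simp_all add: a_def F_def wid_def lev_def h_def)
  have st: "cols r v (Suc m) =
     (?stack @ map (\<lambda>q. F + w' * real (S (R m) + q)) [0..<length ?stack], w',
      F + w' * real (S (R m) + length ?stack))"
    unfolding cols.simps(2) c step_def prod.case Let_def c' R_def[symmetric] U_def[symmetric]
      w'_def[symmetric] S[of "R m", unfolded Suc_eq_plus1] by (rule refl)
  show "lev r v (Suc m) = concat (map sub [0..<R m]) @
      map (\<lambda>q. F + w' * real (S (R m) + q)) [0..<H m (R m)]"
    unfolding lev_def st g unfolding stack by simp
  show "w (Suc m) = w'" unfolding wid_def st by simp
  show "snd (snd (cols r v (Suc m))) = F + w' * real (S (R m) + H m (R m))"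
    unfolding st g by simp
qed

lemma w_Suc: "w (Suc m) = w m / real (R m)"
  by (rule cols_Suc_components)

lemma h_Suc: "h (Suc m) = 2 * H m (R m)"
proof -
  show ?thesis
    unfolding h_def[of "Suc m"] cols_Suc_components(1)
    by (simp only: length_append length_concat_map_upt cols_Suc_components(4)) (simp add: H_def h_def)
qed

lemma lev_Suc_nth:
  assumes "i < R m" "j < h m"
  shows "lev r v (Suc m) ! (H m i + j) = lev r v m ! j + real i * w (Suc m)"
proof -
  have "H m i + j < H m (Suc i)" using assms by (simp add: H_def)
  also have "\<dots> \<le> H m (R m)" unfolding H_def
    by (rule sum_mono2) (use assms in auto)
  finally have lt: "H m i + j < H m (R m)" .
  \<comment> \<open>\<open>H\<close> as the total length of the first \<open>n\<close> pieces, the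
    form in which \<open>nth_concat_map_upt\<close> locates an entry.\<close>
  have H: "H m n = (\<Sum>i<n. length (map (\<lambda>x. x + real i * (w m / real (R m))) (lev r v m) @
     map (\<lambda>q. snd (snd (cols r v m)) + w m / real (R m) *
           real ((\<Sum>j<i. spc (h m) (R m) (U m) (Suc j)) + q))
        [0..<spc (h m) (R m) (U m) (Suc i)]))" for n
    by (simp add: H_def h_def)
  show ?thesis
    unfolding cols_Suc_components(1)
    apply (subst nth_append)
    apply (subst length_concat_map_upt)
    apply (subst H[symmetric])
    apply (simp only: lt if_True)
    apply (subst H)
    apply (subst nth_concat_map_upt[OF assms(1)])
    using assms by (auto simp: h_def nth_append w_Suc)
qed

lemma w_pos [simp]: "0 < w m"
proof (induction m)
  case (Suc m)
  then show ?case using R_ge_2[of m] by (simp add: w_Suc)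
qed (simp add: wid_def)

text \<open>Every endpoint is a multiple of the current width, so that a column of height h and width w
  consists of the intervals [t w, (t + 1) w), t < h, in some order.\<close>
lemma set_lev: "set (lev r v m) = (\<lambda>t. w m * real t) ` {..<h m}"
  and snd_snd_cols: "snd (snd (cols r v m)) = w m * real (h m)"
proof (induction m)
  case 0
  { case 1 show ?case by (auto simp: lev_def h_def) }
  { case 2 show ?case by (auto simp: lev_def h_def wid_def) }
next
  case (Suc m)
  define w' where "w' = w m / real (R m)"
  define S where "S i = (\<Sum>j<i. spc (h m) (R m) (U m) (Suc j))" for i
  have w: "w m = real (R m) * w'" using R_ge_2[of m] by (simp add: w'_def)
  have HS: "H m i = i * h m + S i" for i by (simp add: H_def S_def sum.distrib)
  have F: "snd (snd (cols r v m)) = w' * real (h m * R m)"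
    using Suc by (simp add: w)
  { case 2
    show ?case unfolding cols_Suc_components(3) cols_Suc_components(2) h_Suc
      unfolding S_def[symmetric] w'_def[symmetric] F HS
      by (simp add: algebra_simps) }
  { case 1
    \<comment> \<open>The spacer blocks of the successive subcolumns are consecutive and tile [0, S
      n).\<close>
    have aux: "(\<exists>i<n. \<exists>q<spc (h m) (R m) (U m) (Suc i). t = S i + q) \<longleftrightarrow> t < S n" for n t
    proof (induction n)
      case (Suc n)
      have "(\<exists>q<spc (h m) (R m) (U m) (Suc n). t = S n + q) \<longleftrightarrow> S n \<le> t \<and> t < S (Suc n)"
        by (auto simp: S_def intro!: exI[of _ "t - S n"])
      moreover have "S n \<le> S (Suc n)" by (simp add: S_def)
      ultimately show ?case using Suc by (auto simp: less_Suc_eq)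
    qed (simp add: S_def)
    \<comment> \<open>Division with remainder: piece \<open>i\<close> of the old interval with
      number \<open>t\<close> is the new interval with number \<open>t * R m + i\<close>.\<close>
    have dm: "(\<exists>t<h m. \<exists>i<R m. y = t * R m + i) \<longleftrightarrow> y < h m * R m" for y
    proof
      assume "\<exists>t<h m. \<exists>i<R m. y = t * R m + i"
      then obtain t i where ti: "t < h m" "i < R m" "y = t * R m + i" by blast
      have "y < Suc t * R m" using ti by simp
      also have "\<dots> \<le> h m * R m" using ti by (intro mult_right_mono) auto
      finally show "y < h m * R m" .
    next
      assume y: "y < h m * R m"
      then have "y div R m < h m" by (simp add: less_mult_imp_div_less)
      moreover have "y mod R m < R m" using R_ge_2[of m] by (intro mod_less_divisor) simp
      ultimately show "\<exists>t<h m. \<exists>i<R m. y = t * R m + i"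
        by (metis div_mult_mod_eq)
    qed
    let ?F = "\<lambda>t::nat. w' * real t"
    \<comment> \<open>Three consecutive blocks of multiples of \<open>w'\<close>: the cut levels,
      the spacers over the subcolumns, the final spacers.\<close>
    have "set (lev r v (Suc m)) =
        (\<Union>i<R m. (\<lambda>x. x + real i * w') ` set (lev r v m))
      \<union> (\<Union>i<R m. (\<lambda>q. ?F (h m * R m + (S i + q))) ` {..<spc (h m) (R m) (U m) (Suc i)})
      \<union> (\<lambda>q. ?F (h m * R m + S (R m) + q)) ` {..<H m (R m)}"
      unfolding cols_Suc_components(1)
      unfolding S_def[symmetric] w'_def[symmetric] F
      by (auto simp: algebra_simps lessThan_atLeast0)
    also have "(\<Union>i<R m. (\<lambda>x. x + real i * w') ` set (lev r v m)) = ?F ` {..<h m * R m}"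
    proof -
      have "(\<Union>i<R m. (\<lambda>x. x + real i * w') ` set (lev r v m)) =
         ?F ` {y. \<exists>t<h m. \<exists>i<R m. y = t * R m + i}"
        (is "?A = ?B")
      proof
        show "?A \<subseteq> ?B"
        proof
          fix x assume "x \<in> ?A"
          then obtain i t where "i < R m" "t < h m" "x = w m * real t + real i * w'"
            unfolding Suc.IH(1) by auto
          then have "x = ?F (t * R m + i)" "t * R m + i \<in> {y. \<exists>t<h m. \<exists>i<R m. y = t * R m + i}"
            by (auto simp: w algebra_simps)
          then show "x \<in> ?B" by (rule image_eqI)
        qed
        show "?B \<subseteq> ?A"
        proof
          fix x assume "x \<in> ?B"
          then obtain i t where "i < R m" "t < h m" "x = ?F (t * R m + i)" by auto
          then have "x = w m * real t + real i * w'" by (simp add: w algebra_simps)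
          then show "x \<in> ?A" unfolding Suc.IH(1) using \<open>i < R m\<close> \<open>t < h m\<close> by blast
        qed
      qed
      then show ?thesis using dm by (simp add: lessThan_def)
    qed
    also have "(\<Union>i<R m. (\<lambda>q. ?F (h m * R m + (S i + q))) ` {..<spc (h m) (R m) (U m) (Suc i)}) =
        ?F ` {h m * R m ..< h m * R m + S (R m)}"
    proof -
      have "(\<Union>i<R m. (\<lambda>q. ?F (h m * R m + (S i + q))) ` {..<spc (h m) (R m) (U m) (Suc i)}) =
         (\<lambda>t. ?F (h m * R m + t)) ` {t. \<exists>i<R m. \<exists>q<spc (h m) (R m) (U m) (Suc i). t = S i + q}"
        (is "?A = ?B")
      proof
        show "?A \<subseteq> ?B" by blast
        show "?B \<subseteq> ?A" by blast
      qed
      also have "\<dots> = ?F ` ((\<lambda>t. h m * R m + t) ` {0..<S (R m)})"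
        unfolding aux image_image by (simp add: lessThan_def atLeast0LessThan)
      finally show ?thesis by (simp add: add.commute)
    qed
    also have "(\<lambda>q. ?F (h m * R m + S (R m) + q)) ` {..<H m (R m)} =
        ?F ` {h m * R m + S (R m) ..< h m * R m + S (R m) + H m (R m)}"
    proof -
      have "(\<lambda>q. ?F (h m * R m + S (R m) + q)) ` {..<H m (R m)} =
          ?F ` ((\<lambda>q. h m * R m + S (R m) + q) ` {0..<H m (R m)})"
        by (simp add: image_image atLeast0LessThan)
      then show ?thesis by (simp add: add.commute)
    qed
    also have "?F ` {..<h m * R m} \<union> ?F ` {h m * R m..<h m * R m + S (R m)} \<union>
       ?F ` {h m * R m + S (R m)..<h m * R m + S (R m) + H m (R m)} = ?F ` {..<h (Suc m)}"
      unfolding image_Un[symmetric] h_Suc HS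
      by (rule arg_cong[where f="image ?F"]) (auto simp: mult.commute)
    finally show ?case by (simp add: w_Suc w'_def) }
qed

lemma h_pos [simp]: "0 < h m"
proof (induction m)
  case 0 show ?case by (simp add: h_def lev_def)
next
  case (Suc m)
  have "h m \<le> H m 1" by (simp add: H_def)
  also have "\<dots> \<le> H m (R m)" unfolding H_def
    by (rule sum_mono2) (use R_ge_2[of m] in auto)
  finally show ?case using Suc by (simp add: h_Suc)
qed

lemma H_mono_gap: "i < j \<Longrightarrow> H m i + h m \<le> H m j"
proof -
  assume "i < j"
  have "H m i + h m \<le> H m (Suc i)" by (simp add: H_def)
  also have "\<dots> \<le> H m j" unfolding H_def
    by (rule sum_mono2) (use \<open>i < j\<close> in auto)
  finally show ?thesis .
qed

lemma H_add_lt: "i < R m \<Longrightarrow> j < h m \<Longrightarrow> 2 * (H m i + j) < h (Suc m)"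
  using H_mono_gap[of i "R m" m] by (simp add: h_Suc)

lemma H_add_inj:
  assumes "H m i + p = H m j + q" "p < h m" "q < h m"
  shows "i = j \<and> p = q"
  using assms H_mono_gap[of i j m] H_mono_gap[of j i m] by (cases i j rule: linorder_cases) auto

section \<open>Arithmetic of the subcolumn heights\<close>

text \<open>\<open>gap m\<close> is the height of each of the first \<open>b m\<close> subcolumns
  with its spacers; \<open>tail_height m d\<close> is the height of the bottom of subcolumn
  \<open>b m + d\<close> above that of subcolumn \<open>b m\<close>.\<close>

definition "gap m = (2 * L + 2) * h m + sum_list (U m)"
definition "tail_height m d = 2 * d * h m + sum_list (take d (U m))"

lemma H_body: "i \<le> b m \<Longrightarrow> H m i = i * gap m"
proof (induction i)
  case (Suc i)
  then have "spc (h m) (R m) (U m) (Suc i) = (2 * L + 1) * h m + sum_list (U m)"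
    by (simp add: spc_def b_def)
  with Suc show ?case by (simp add: H_def gap_def algebra_simps)
qed (simp add: H_def)

lemma H_tail_Suc: "d < L \<Longrightarrow> H m (b m + Suc d) = H m (b m + d) + 2 * h m + U m ! d"
proof -
  assume "d < L"
  then have "spc (h m) (R m) (U m) (Suc (b m + d)) = h m + U m ! d"
    by (simp add: spc_def R_eq)
  then show ?thesis by (simp add: H_def)
qed

lemma H_tail: "d \<le> L \<Longrightarrow> H m (b m + d) = b m * gap m + tail_height m d"
proof (induction d)
  case 0 then show ?case by (simp add: H_body tail_height_def)
next
  case (Suc d)
  then show ?case using H_tail_Suc[of d m]
    by (simp add: tail_height_def sum_list_take_Suc)
qed

lemma tail_height_mono:
  assumes "d < d'" "d' \<le> L"
  shows "tail_height m d + 2 * h m \<le> tail_height m d'"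
proof -
  have "Suc d \<le> d'" using assms by simp
  then have "2 * Suc d * h m \<le> 2 * d' * h m" by (intro mult_right_mono) auto
  moreover have "sum_list (take d (U m)) \<le> sum_list (take d' (U m))"
  proof -
    have "take d' (U m) = take d (U m) @ take (d' - d) (drop d (U m))"
      using take_add[of d "d' - d" "U m"] assms by simp
    then show ?thesis by simp
  qed
  ultimately show ?thesis by (simp add: tail_height_def)
qed

text \<open>The spacer number (2L+1)h + \<sigma> is made for this: the largest tail height is 2Lh +
  \<sigma>, and \<open>gap m\<close> exceeds it by exactly 2h.\<close>

lemma tail_height_le: "d \<le> L \<Longrightarrow> tail_height m d + 2 * h m \<le> gap m"
proof -
  assume "d \<le> L"
  then have "tail_height m d \<le> tail_height m L"
    using tail_height_mono[of d L m] by (cases "d = L") auto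
  then show ?thesis by (simp add: gap_def tail_height_def)
qed

text \<open>Body and tail in one normal form, a two-digit expansion: \<open>q\<close> counts gaps,
  and the second digit can be nonzero only once \<open>q\<close> has reached
  \<open>b m\<close>.\<close>

lemma H_cases:
  assumes "i < R m"
  obtains q d where "q \<le> b m" "d \<le> L" "d > 0 \<Longrightarrow> q = b m" "i < b m \<Longrightarrow> d = 0 \<and> q < b m"
    "int (H m i) = int q * int (gap m) + int (tail_height m d)"
proof (cases "i < b m")
  case True
  then show thesis using that[of i 0] by (simp add: H_body tail_height_def)
next
  case False
  then obtain d where d: "i = b m + d" using le_Suc_ex not_less by blast
  with assms have "d \<le> L" by (simp add: R_eq)
  then show thesis using that[of "b m" d] d by (simp add: H_tail)
qed

text \<open>The possible height differences are separated by twice the height of the column, except for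
  those between two of the last L + 1 subcolumns; only there do the increments u interfere.\<close>
lemma H_diff_rigid:
  assumes "i < b m" "i' < R m" "j < R m" "j' < R m"
    and "\<bar>(int (H m i') - int (H m i)) - (int (H m j') - int (H m j))\<bar> < 2 * int (h m)"
  shows "int (H m i') - int (H m i) = int (H m j') - int (H m j)"
proof -
  define a where "a = int (gap m)"
  define t where "t d = int (tail_height m d)" for d
  define hh where "hh = int (h m)"
  have iR: "i < R m" using assms(1) by (simp add: R_eq)
  obtain q d where i: "q \<le> b m" "d \<le> L" "d = 0" "q < b m" "int (H m i) = int q * a + t d"
    using H_cases[OF iR] assms(1) unfolding a_def t_def by metis
  obtain q' d' where i': "q' \<le> b m" "d' \<le> L" "d' > 0 \<Longrightarrow> q' = b m" "int (H m i') = int q' * a + t d'"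
    using H_cases[OF assms(2)] unfolding a_def t_def by metis
  obtain Q D where j: "Q \<le> b m" "D \<le> L" "D > 0 \<Longrightarrow> Q = b m" "int (H m j) = int Q * a + t D"
    using H_cases[OF assms(3)] unfolding a_def t_def by metis
  obtain Q' D' where j': "Q' \<le> b m" "D' \<le> L" "D' > 0 \<Longrightarrow> Q' = b m" "int (H m j') = int Q' * a + t D'"
    using H_cases[OF assms(4)] unfolding a_def t_def by metis
  have t0: "t 0 = 0" by (simp add: t_def tail_height_def)
  have hh: "0 < hh" by (simp add: hh_def)
  have tle: "t e + 2 * hh \<le> a" if "e \<le> L" for e
    using tail_height_le[OF that, of m] unfolding t_def hh_def a_def by linarith
  have tmono: "t e + 2 * hh \<le> t e'" if "e < e'" "e' \<le> L" for e e'
    using tail_height_mono[OF that, of m] unfolding t_def hh_def by linarith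
  have tpos: "0 \<le> t e" for e by (simp add: t_def)
  have tpos': "2 * hh \<le> t e" if "0 < e" "e \<le> L" for e
    using tmono[of 0 e] that t0 by simp
  have tinj: "e = e'" if "\<bar>t e - t e'\<bar> < 2 * hh" "e \<le> L" "e' \<le> L" for e e'
    using that tmono[of e e'] tmono[of e' e] by (cases e e' rule: linorder_cases) auto
  have apos: "0 \<le> a" by (simp add: a_def)
  \<comment> \<open>A nonzero multiple of \<open>a\<close> has modulus at least \<open>a\<close>,
    whereas tails lie in [0, a - 2 hh]. The cases below play these two facts against each
    other.\<close>
  have zcase: "z = 0 \<or> z * a \<ge> a \<or> z * a \<le> - a" for z :: int
  proof -
    have "1 * a \<le> z * a" if "1 \<le> z" using that apos by (intro mult_right_mono) auto
    moreover have "z * a \<le> (-1) * a" if "z \<le> -1" using that apos by (intro mult_right_mono) auto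
    moreover have "z = 0 \<or> 1 \<le> z \<or> z \<le> -1" by linarith
    ultimately show ?thesis by auto
  qed
  define z where "z = int q' - int q"
  define y where "y = int Q' - int Q"
  have \<delta>: "int (H m i') - int (H m i) = z * a + t d'"
    using i i' t0 by (simp add: z_def algebra_simps)
  have \<delta>': "int (H m j') - int (H m j) = y * a + t D' - t D"
    using j j' by (simp add: y_def algebra_simps)
  have close: "\<bar>z * a + t d' - (y * a + t D' - t D)\<bar> < 2 * hh"
    using assms(5) unfolding \<delta> \<delta>' hh_def .
  have sub: "(z - y) * a = z * a - y * a" by (simp add: algebra_simps)
  have "z * a + t d' = y * a + t D' - t D"
  proof (cases "D = 0")
    case True
    \<comment> \<open>Now each side is a multiple of \<open>a\<close> plus one tail. The tails
      differ by at most a - 2 hh, so the multiples agree; tails less than 2 hh apart are then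
      equal.\<close>
    have "t D = 0" using True t0 by simp
    then have "z - y = 0"
      using zcase[of "z - y"] close tle[OF i'(2)] tle[OF j'(2)] tpos[of d'] tpos[of D'] sub
      by linarith
    moreover from this have "d' = D'"
      using close True t0 by (intro tinj) (use i' j' in auto)
    ultimately show ?thesis using True t0 by simp
  next
    case False
    then have Q: "Q = b m" using j by simp
    have tD: "2 * hh \<le> t D" "t D + 2 * hh \<le> a" using tpos'[of D] tle[of D] False j by auto
    \<comment> \<open>Otherwise \<open>i'\<close> lies in the tail and \<open>i\<close> in the body,
      so the first difference is at least a + 2 hh; the second one starts in the tail and stays
      below \<open>a\<close>.\<close>
    have "d' = 0"
    proof (rule ccontr)
      assume "d' \<noteq> 0"
      then have "z \<ge> 1" "2 * hh \<le> t d'" using i i' tpos'[of d'] by (auto simp: z_def)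
      then have "1 * a \<le> z * a" using apos by (intro mult_right_mono) auto
      moreover have "y * a \<le> 0 * a" using Q j' apos by (intro mult_right_mono) (auto simp: y_def)
      ultimately show False using close \<open>2 * hh \<le> t d'\<close> tD tle[OF j'(2)] tpos[of D'] hh by linarith
    qed
    show ?thesis
    proof (cases "D' = 0")
      case True
      \<comment> \<open>Contradictory case: \<open>t D\<close> would be within 2 hh of a multiple of
        \<open>a\<close>, but it lies between 2 hh and a - 2 hh.\<close>
      then show ?thesis
        using zcase[of "z - y"] close \<open>d' = 0\<close> t0 tD sub hh by auto
    next
      case False
      \<comment> \<open>Both \<open>j\<close> and \<open>j'\<close> lie in the tail, so their
        difference is too small for a nonzero multiple of \<open>a\<close> on the other
        side.\<close>
      then have "y = 0" using j' Q by (simp add: y_def)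
      then have "z = 0"
        using zcase[of z] close \<open>d' = 0\<close> t0 tD tle[OF j'(2)] tpos[of D'] by auto
      then have "D = D'" using close \<open>y = 0\<close> \<open>d' = 0\<close> t0 by (intro tinj) (use j j' in auto)
      then show ?thesis using \<open>y = 0\<close> \<open>z = 0\<close> \<open>d' = 0\<close> t0 by simp
    qed
  qed
  then show ?thesis using \<delta> \<delta>' by simp
qed

section \<open>Levels as disjoint intervals, and the map on them\<close>

lemma lev_nth_eq: "j < h m \<Longrightarrow> \<exists>t<h m. lev r v m ! j = w m * real t"
proof -
  assume "j < h m"
  then have "lev r v m ! j \<in> set (lev r v m)" by (simp add: h_def)
  then show ?thesis unfolding set_lev by blast
qed

text \<open>By counting: the \<open>h m\<close> entries of the list take \<open>h m\<close>
  different values.\<close>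

lemma distinct_lev: "distinct (lev r v m)"
proof -
  have "card (set (lev r v m)) = h m"
    unfolding set_lev by (subst card_image) (auto simp: inj_on_def less_imp_neq[OF w_pos, symmetric])
  then show ?thesis by (simp add: h_def card_distinct)
qed

lemma mem_Level_multiple:
  assumes "x \<in> {w m * real t ..< w m * real t + w m}"
  shows "nat \<lfloor>x / w m\<rfloor> = t"
proof -
  have "real t \<le> x / w m" "x / w m < real t + 1"
    using assms by (auto simp: field_simps)
  then have "\<lfloor>x / w m\<rfloor> = int t" by (intro floor_unique) auto
  then show ?thesis by simp
qed

lemma Level_disjoint:
  assumes "x \<in> Level m i" "x \<in> Level m j" "i < h m" "j < h m"
  shows "i = j"
proof -
  obtain s t where "lev r v m ! i = w m * real s" "lev r v m ! j = w m * real t"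
    using lev_nth_eq assms by meson
  moreover from this have "s = t" using assms mem_Level_multiple by (metis Level_def)
  ultimately show ?thesis
    using distinct_lev assms by (metis h_def nth_eq_iff_index_eq)
qed

lemma UN_Level: "(\<Union>j<h m. Level m j) = {0 ..< w m * real (h m)}"
proof
  show "(\<Union>j<h m. Level m j) \<subseteq> {0 ..< w m * real (h m)}"
  proof
    fix x assume "x \<in> (\<Union>j<h m. Level m j)"
    then obtain t where t: "t < h m" "x \<in> {w m * real t ..< w m * real t + w m}"
      using lev_nth_eq by (metis Level_def UN_E lessThan_iff)
    have "w m * (real t + 1) \<le> w m * real (h m)" using t by (intro mult_left_mono) auto
    moreover have "0 \<le> w m * real t" by (simp add: less_imp_le)
    ultimately show "x \<in> {0 ..< w m * real (h m)}" using t
      unfolding atLeastLessThan_iff distrib_left by linarith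
  qed
  show "{0 ..< w m * real (h m)} \<subseteq> (\<Union>j<h m. Level m j)"
  proof
    fix x assume x: "x \<in> {0 ..< w m * real (h m)}"
    define t where "t = nat \<lfloor>x / w m\<rfloor>"
    have "real t = of_int \<lfloor>x / w m\<rfloor>" using x by (simp add: t_def less_imp_le)
    then have *: "real t \<le> x / w m" "x / w m < real t + 1" by linarith+
    have "x / w m < real (h m)" using x by (simp add: field_simps)
    then have "t < h m" using * by linarith
    then have "w m * real t \<in> set (lev r v m)" unfolding set_lev by blast
    then obtain j where "j < h m" "lev r v m ! j = w m * real t"
      by (auto simp: in_set_conv_nth h_def)
    moreover have "w m * real t \<le> x" "x < w m * real t + w m" using * by (auto simp: field_simps)
    ultimately have "x \<in> Level m j" "j < h m" by (auto simp: Level_def)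
    then show "x \<in> (\<Union>j<h m. Level m j)" by blast
  qed
qed

lemma Level_Suc_cover:
  assumes "x \<in> Level m j" "j < h m"
  shows "\<exists>i<R m. x \<in> Level (Suc m) (H m i + j)"
proof -
  define y where "y = (x - lev r v m ! j) / w (Suc m)"
  have y: "0 \<le> y" "y < real (R m)"
  proof -
    have "x - lev r v m ! j < real (R m) * w (Suc m)"
      using assms R_ge_2[of m] by (simp add: Level_def w_Suc)
    then show "y < real (R m)" by (simp add: y_def pos_divide_less_eq)
    show "0 \<le> y" using assms w_pos[of "Suc m"]
      by (simp add: y_def Level_def zero_le_divide_iff del: w_pos)
  qed
  define i where "i = nat \<lfloor>y\<rfloor>"
  have "real i = of_int \<lfloor>y\<rfloor>" using y by (simp add: i_def)
  then have *: "real i \<le> y" "y < real i + 1" by linarith+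
  then have i: "i < R m" using y by linarith
  have "x = lev r v m ! j + y * w (Suc m)" using w_pos[of "Suc m"] by (simp add: y_def del: w_pos)
  moreover have "real i * w (Suc m) \<le> y * w (Suc m)" using * by simp
  moreover have "y * w (Suc m) < (real i + 1) * w (Suc m)" using * by simp
  ultimately have "x \<in> Level (Suc m) (H m i + j)"
    using lev_Suc_nth[OF i assms(2)] by (simp add: Level_def algebra_simps)
  then show ?thesis using i by blast
qed

lemma Level_Suc_subset:
  assumes "i < R m" "j < h m"
  shows "Level (Suc m) (H m i + j) \<subseteq> Level m j"
proof -
  have "(real i + 1) * w (Suc m) \<le> real (R m) * w (Suc m)"
    using assms by (intro mult_right_mono) (auto intro: less_imp_le)
  also have "\<dots> = w m" using R_ge_2[of m] by (simp add: w_Suc)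
  finally have "(real i + 1) * w (Suc m) \<le> w m" .
  moreover have "0 \<le> real i * w (Suc m)" by (simp add: less_imp_le)
  ultimately show ?thesis using lev_Suc_nth[OF assms] by (auto simp: Level_def algebra_simps)
qed

lemma X_eq: "X = (\<Union>m. {0 ..< w m * real (h m)})"
proof -
  have "(\<Union>a\<in>set (lev r v m). {a..<a + w m}) = (\<Union>j<h m. Level m j)" for m
    unfolding Level_def h_def set_conv_nth by blast
  then show ?thesis unfolding rk_space_def by (simp add: UN_Level)
qed

lemma Level_subset_X: "j < h m \<Longrightarrow> Level m j \<subseteq> X"
  unfolding X_eq UN_Level[symmetric] by blast

text \<open>Cutting splits two adjacent levels into adjacent pairs with the same translation, so the
  motion prescribed by one column is confirmed by all later ones.\<close>

lemma Level_refine: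
  assumes "x \<in> Level m j" "Suc j < h m" "m \<le> n"
  shows "\<exists>q. Suc q < h n \<and> x \<in> Level n q \<and>
     lev r v n ! Suc q - lev r v n ! q = lev r v m ! Suc j - lev r v m ! j"
  using assms(3)
proof (induction rule: dec_induct)
  case base then show ?case using assms by blast
next
  case (step n)
  then obtain q where q: "Suc q < h n" "x \<in> Level n q"
     "lev r v n ! Suc q - lev r v n ! q = lev r v m ! Suc j - lev r v m ! j" by blast
  obtain i where i: "i < R n" "x \<in> Level (Suc n) (H n i + q)"
    using Level_Suc_cover[of x n q] q by auto
  have "Suc (H n i + q) < h (Suc n)" using H_add_lt[OF i(1) q(1)] by simp
  moreover have "lev r v (Suc n) ! Suc (H n i + q) - lev r v (Suc n) ! (H n i + q) =
     lev r v n ! Suc q - lev r v n ! q"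
    using lev_Suc_nth[OF i(1) q(1)] lev_Suc_nth[OF i(1), of q] q by simp
  ultimately show ?case using i q by (intro exI[of _ "H n i + q"]) auto
qed

text \<open>The final spacers push every old level below the top of the next column, and refinement
  keeps the point off the top from then on.\<close>

lemma ex_Level_nontop:
  assumes "x \<in> X"
  obtains n where "\<And>m. n \<le> m \<Longrightarrow> \<exists>j. Suc j < h m \<and> x \<in> Level m j"
proof -
  obtain n j where "j < h n" "x \<in> Level n j"
    using assms unfolding X_eq UN_Level[symmetric] by blast
  then obtain i where i: "i < R n" "x \<in> Level (Suc n) (H n i + j)"
    using Level_Suc_cover by blast
  have "Suc (H n i + j) < h (Suc n)"
    using \<open>j < h n\<close> H_mono_gap[OF i(1), of n]
      R_ge_2[of n] H_mono_gap[of 0 1 n] H_mono_gap[of 1 "R n" n] h_pos[of n] unfolding h_Suc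
    by linarith
  with i show thesis using Level_refine that[of "Suc n"] by blast
qed

text \<open>The choice in \<open>rk_map\<close> is immaterial: the chosen column and the given one
  are compared in the later of the two, where the level of \<open>x\<close> is unique.\<close>

lemma T_Level:
  assumes "x \<in> Level m j" "Suc j < h m"
  shows "T x = x + (lev r v m ! Suc j - lev r v m ! j)"
proof -
  let ?P = "\<lambda>(m, j). Suc j < length (lev r v m) \<and> x \<in> {lev r v m ! j ..< lev r v m ! j + w m}"
  have "?P (m, j)" using assms by (simp add: Level_def h_def)
  then have "?P (SOME p. ?P p)" by (rule someI[where P="?P"])
  then obtain n q where nq: "(SOME p. ?P p) = (n, q)" "Suc q < h n" "x \<in> Level n q"
    by (cases "SOME p. ?P p") (auto simp: h_def Level_def)
  have "T x = x + (lev r v n ! Suc q - lev r v n ! q)"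
    unfolding rk_map_def using \<open>?P (m, j)\<close> nq(1) by auto
  moreover obtain q1 where "Suc q1 < h (max m n)" "x \<in> Level (max m n) q1"
     "lev r v (max m n) ! Suc q1 - lev r v (max m n) ! q1 = lev r v m ! Suc j - lev r v m ! j"
    using Level_refine[OF assms, of "max m n"] by auto
  moreover obtain q2 where "Suc q2 < h (max m n)" "x \<in> Level (max m n) q2"
     "lev r v (max m n) ! Suc q2 - lev r v (max m n) ! q2 = lev r v n ! Suc q - lev r v n ! q"
    using Level_refine[OF nq(3,2), of "max m n"] by auto
  moreover from calculation have "q1 = q2" by (intro Level_disjoint[of x "max m n"]) auto
  ultimately show ?thesis by simp
qed

lemma T_mem_Level: "x \<in> Level m j \<Longrightarrow> Suc j < h m \<Longrightarrow> T x \<in> Level m (Suc j)"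
  by (auto simp: T_Level Level_def)

lemma T_inj:
  assumes "x \<in> X" "y \<in> X" "T x = T y"
  shows "x = y"
proof -
  obtain n1 n2 where n: "\<And>m. n1 \<le> m \<Longrightarrow> \<exists>j. Suc j < h m \<and> x \<in> Level m j"
    "\<And>m. n2 \<le> m \<Longrightarrow> \<exists>j. Suc j < h m \<and> y \<in> Level m j"
    using ex_Level_nontop assms by metis
  define m where "m = max n1 n2"
  obtain i j where ij: "Suc i < h m" "x \<in> Level m i" "Suc j < h m" "y \<in> Level m j"
    using n[of m] by (auto simp: m_def)
  then have "i = j"
    using T_mem_Level[of x m i] T_mem_Level[of y m j] Level_disjoint[of "T x" m "Suc i" "Suc j"] assms(3) by auto
  have "x + (lev r v m ! Suc i - lev r v m ! i) = y + (lev r v m ! Suc j - lev r v m ! j)"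
    using assms(3) unfolding T_Level[OF ij(2,1)] T_Level[OF ij(4,3)] .
  then show ?thesis unfolding \<open>i = j\<close> by simp
qed

lemma T_in_X: "x \<in> X \<Longrightarrow> T x \<in> X"
proof -
  assume "x \<in> X"
  then obtain m where "\<exists>j. Suc j < h m \<and> x \<in> Level m j"
    using ex_Level_nontop by blast
  then obtain j where "Suc j < h m" "x \<in> Level m j" by blast
  then show ?thesis using T_mem_Level Level_subset_X[of "Suc j" m] by blast
qed

text \<open>Translating back from level \<open>Suc j\<close> yields one preimage in level
  \<open>j\<close>; injectivity excludes any other.\<close>

lemma T_vimage_Level:
  assumes "Suc j < h m"
  shows "T -` (E \<inter> Level m (Suc j)) \<inter> X =
    {x \<in> Level m j. x + (lev r v m ! Suc j - lev r v m ! j) \<in> E}" (is "?A = ?B")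
proof
  show "?B \<subseteq> ?A"
  proof
    fix x assume x: "x \<in> ?B"
    moreover from this have "x \<in> X" using Level_subset_X[of j m] assms by auto
    ultimately show "x \<in> ?A" using T_Level[of x m j] T_mem_Level[of x m j] assms by simp
  qed
  show "?A \<subseteq> ?B"
  proof
    fix x assume x: "x \<in> ?A"
    define z where "z = T x - (lev r v m ! Suc j - lev r v m ! j)"
    have z: "z \<in> Level m j" using x by (auto simp: z_def Level_def)
    then have "T z = T x" using T_Level[of z m j] assms by (simp add: z_def)
    moreover have "z \<in> X" using z Level_subset_X[of j m] assms by auto
    ultimately have "z = x" using T_inj x by auto
    then show "x \<in> ?B" using z x T_Level[of x m j] assms by auto
  qed
qed

text \<open>The bottom levels therefore shrink to the point 0, the only point of \<open>X\<close>
  without a preimage.\<close>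

lemma lev_nth_0: "lev r v m ! 0 = 0"
proof (induction m)
  case (Suc m)
  have "H m 0 = 0" by (simp add: H_def)
  then show ?case using lev_Suc_nth[of 0 m 0] Suc R_ge_2[of m] by simp
qed (simp add: lev_def)

section \<open>The product measure on cubes\<close>

abbreviation "M \<equiv> rk_measure r v"
abbreviation "P \<equiv> PiM {..<k} (\<lambda>_. M)"

lemma w_le_power: "w m \<le> (1/2) ^ m"
proof (induction m)
  case (Suc m)
  have "w (Suc m) \<le> w m / 2"
    unfolding w_Suc using R_ge_2[of m] by (intro divide_left_mono) (auto simp: less_imp_le)
  then show ?case using Suc by simp
qed (simp add: wid_def)

lemma w_small:
  assumes "0 < e"
  obtains m where "n \<le> m" "w m < e"
proof -
  have "(\<lambda>m. (1/2::real) ^ m) \<longlonglongrightarrow> 0" by (rule LIMSEQ_realpow_zero) auto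
  then have "\<forall>\<^sub>F m in sequentially. (1/2::real) ^ m < e"
    using assms by (simp add: order_tendsto_iff)
  then obtain N where "\<And>m. N \<le> m \<Longrightarrow> (1/2::real) ^ m < e"
    by (auto simp: eventually_sequentially)
  then show thesis using that[of "max n N"] w_le_power[of "max n N"] by (meson max.cobounded1 max.cobounded2 le_less_trans)
qed

lemma Level_borel [measurable, simp]: "Level m j \<in> sets borel"
  by (simp add: Level_def)

lemma X_borel [measurable, simp]: "X \<in> sets borel"
  unfolding X_eq by (intro sets.countable_UN) auto

lemma space_M [simp]: "space M = X"
  by (simp add: rk_measure_def space_restrict_space)

lemma sets_M: "E \<in> sets M \<longleftrightarrow> E \<subseteq> X \<and> E \<in> sets lebesgue"
  unfolding rk_measure_def by (subst sets_restrict_space_iff) auto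

lemma emeasure_M: "E \<in> sets M \<Longrightarrow> emeasure M E = emeasure lebesgue E"
  unfolding rk_measure_def
  by (subst emeasure_restrict_space) (auto simp: sets_M[unfolded rk_measure_def])

lemma Level_sets [simp]: "j < h m \<Longrightarrow> Level m j \<in> sets M"
  by (simp add: sets_M Level_subset_X)

lemma emeasure_Level: "j < h m \<Longrightarrow> emeasure M (Level m j) = ennreal (w m)"
  by (simp add: emeasure_M) (simp add: Level_def less_imp_le)

lemma sigma_finite_M: "sigma_finite_measure M"
proof
  let ?A = "range (\<lambda>m. {0 ..< w m * real (h m)})"
  have "{0 ..< w m * real (h m)} \<in> sets M" for m
    by (auto simp: sets_M X_eq)
  then show "\<exists>A. countable A \<and> A \<subseteq> sets M \<and> \<Union> A = space M \<and> (\<forall>a\<in>A. emeasure M a \<noteq> \<infinity>)"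
    by (intro exI[of _ ?A]) (auto simp: X_eq emeasure_M less_imp_le)
qed

sublocale PM: product_sigma_finite "\<lambda>_::nat. M"
  using sigma_finite_M by (simp add: product_sigma_finite_def)

section \<open>Measurability and measure preservation\<close>

lemma T_vimage_translate:
  assumes "E \<in> sets M" "Suc j < h m"
  shows "T -` (E \<inter> Level m (Suc j)) \<inter> X \<in> sets M"
    and "emeasure M (T -` (E \<inter> Level m (Suc j)) \<inter> X) = emeasure M (E \<inter> Level m (Suc j))"
proof -
  define \<delta> where "\<delta> = lev r v m ! Suc j - lev r v m ! j"
  have eq: "T -` (E \<inter> Level m (Suc j)) \<inter> X = (\<lambda>x. - \<delta> + x) ` (E \<inter> Level m (Suc j))"
    unfolding T_vimage_Level[OF assms(2)]
    by (auto simp: Level_def \<delta>_def image_iff intro!: bexI[of _ "_ + (lev r v m ! Suc j - lev r v m ! j)"])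
  have E: "E \<inter> Level m (Suc j) \<in> sets M" using assms by auto
  then have "E \<inter> Level m (Suc j) \<in> sets lebesgue" by (simp add: sets_M)
  then have "(\<lambda>x. - \<delta> + x) ` (E \<inter> Level m (Suc j)) \<in> sets lebesgue"
    by (rule lebesgue_sets_translation)
  then show *: "T -` (E \<inter> Level m (Suc j)) \<inter> X \<in> sets M"
    unfolding sets_M eq[symmetric] by blast
  have "emeasure lebesgue ((\<lambda>x. - \<delta> + x) ` (E \<inter> Level m (Suc j))) = emeasure lebesgue (E \<inter> Level m (Suc j))"
    using emeasure_lebesgue_affine[of 1 "- \<delta>" "E \<inter> Level m (Suc j)"] by (simp add: add.commute)
  then show "emeasure M (T -` (E \<inter> Level m (Suc j)) \<inter> X) = emeasure M (E \<inter> Level m (Suc j))"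
    using emeasure_M[OF *] emeasure_M[OF E] eq by simp
qed

text \<open>The part of column \<open>m\<close> on which that column already determines the inverse
  of \<open>T\<close>. These sets increase to \<open>X\<close> without 0, so preimages can be
  handled level by level and then in the limit.\<close>

definition "nonbase m = (\<Union>j<h m - 1. Level m (Suc j))"

lemma nonbaseI: "Suc j < h m \<Longrightarrow> x \<in> Level m (Suc j) \<Longrightarrow> x \<in> nonbase m"
  unfolding nonbase_def by (rule UN_I[of j]) auto

lemma nonbase_mono: "incseq nonbase"
proof (rule incseq_SucI, rule subsetI)
  fix m x assume "x \<in> nonbase m"
  then obtain j where "j < h m - 1" and j: "x \<in> Level m (Suc j)" unfolding nonbase_def by blast
  then have j: "Suc j < h m" "x \<in> Level m (Suc j)" by simp_all
  then obtain i where i: "i < R m" "x \<in> Level (Suc m) (H m i + Suc j)"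
    using Level_Suc_cover by blast
  have "H m i + Suc j < h (Suc m)" using H_add_lt[OF i(1) j(1)] by simp
  then show "x \<in> nonbase (Suc m)" using i by (auto intro!: nonbaseI[of "H m i + j"])
qed

lemma UN_nonbase: "X - {0} \<subseteq> (\<Union>m. nonbase m)"
proof
  fix x assume x: "x \<in> X - {0}"
  then have "0 < x" by (auto simp: X_eq)
  obtain n where n: "\<And>m. n \<le> m \<Longrightarrow> \<exists>j. Suc j < h m \<and> x \<in> Level m j"
    using ex_Level_nontop x by blast
  obtain m where m: "n \<le> m" "w m < x" using w_small[OF \<open>0 < x\<close>] .
  obtain j where j: "Suc j < h m" "x \<in> Level m j" using n[OF m(1)] by blast
  have "j \<noteq> 0" using j m lev_nth_0[of m] by (intro notI) (simp add: Level_def)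
  then obtain i where "j = Suc i" using not0_implies_Suc by blast
  then have "x \<in> nonbase m" using j by (intro nonbaseI[of i]) auto
  then show "x \<in> (\<Union>m. nonbase m)" by blast
qed

lemma T_mem_nonbase: "x \<in> X \<Longrightarrow> T x \<in> (\<Union>m. nonbase m)"
proof -
  assume "x \<in> X"
  then obtain m where "\<exists>j. Suc j < h m \<and> x \<in> Level m j"
    using ex_Level_nontop by blast
  then obtain j where "Suc j < h m" "x \<in> Level m j" by blast
  then have "T x \<in> nonbase m" using T_mem_Level nonbaseI by blast
  then show ?thesis by blast
qed

lemma T_vimage_nonbase:
  assumes "E \<in> sets M"
  shows "T -` (E \<inter> nonbase m) \<inter> X \<in> sets M"
    and "emeasure M (T -` (E \<inter> nonbase m) \<inter> X) = emeasure M (E \<inter> nonbase m)"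
proof -
  let ?E = "\<lambda>j. E \<inter> Level m (Suc j)"
  have E: "E \<inter> nonbase m = (\<Union>j<h m - 1. ?E j)" by (auto simp: nonbase_def)
  have V: "T -` (E \<inter> nonbase m) \<inter> X = (\<Union>j<h m - 1. T -` ?E j \<inter> X)" by (auto simp: nonbase_def)
  show "T -` (E \<inter> nonbase m) \<inter> X \<in> sets M"
    unfolding V using T_vimage_translate(1)[OF assms] by (intro sets.finite_UN) auto
  have dj: "disjoint_family_on ?E {..<h m - 1}"
    using Level_disjoint[of _ m "Suc _" "Suc _"] by (fastforce simp: disjoint_family_on_def)
  then have dj': "disjoint_family_on (\<lambda>j. T -` ?E j \<inter> X) {..<h m - 1}"
    unfolding disjoint_family_on_def by blast
  have "emeasure M (T -` (E \<inter> nonbase m) \<inter> X) = (\<Sum>j<h m - 1. emeasure M (T -` ?E j \<inter> X))"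
    unfolding V using T_vimage_translate(1)[OF assms]
    by (intro sum_emeasure[symmetric] dj') auto
  also have "\<dots> = (\<Sum>j<h m - 1. emeasure M (?E j))"
    using T_vimage_translate(2)[OF assms] by (intro sum.cong) auto
  also have "\<dots> = emeasure M (E \<inter> nonbase m)"
    unfolding E using assms by (intro sum_emeasure dj) auto
  finally show "emeasure M (T -` (E \<inter> nonbase m) \<inter> X) = emeasure M (E \<inter> nonbase m)" .
qed

lemma T_measurable: "T \<in> M \<rightarrow>\<^sub>M M"
proof (rule measurableI)
  fix E assume E: "E \<in> sets M"
  have "T -` E \<inter> space M = (\<Union>m. T -` (E \<inter> nonbase m) \<inter> X)"
    using T_mem_nonbase by auto
  also have "\<dots> \<in> sets M" using T_vimage_nonbase(1)[OF E] by (intro sets.countable_UN) blast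
  finally show "T -` E \<inter> space M \<in> sets M" .
qed (use T_in_X in auto)

lemma T_measure_preserving:
  assumes "E \<in> sets M"
  shows "emeasure M (T -` E \<inter> X) = emeasure M E"
proof -
  have nb: "nonbase m \<in> sets M" for m by (auto simp: nonbase_def)
  have 0: "{0} \<in> null_sets M"
  proof -
    have "0 \<in> X" using w_pos[of 0] h_pos[of 0] by (auto simp: X_eq intro!: exI[of _ 0])
    then have "{0} \<in> sets M" by (simp add: sets_M)
    then show ?thesis by (simp add: null_sets_def emeasure_M)
  qed
  have inc: "incseq (\<lambda>m. E \<inter> nonbase m)" "incseq (\<lambda>m. T -` (E \<inter> nonbase m) \<inter> X)"
    using nonbase_mono unfolding incseq_def by blast+
  have "T -` E \<inter> X = (\<Union>m. T -` (E \<inter> nonbase m) \<inter> X)" using T_mem_nonbase by auto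
  then have "emeasure M (T -` E \<inter> X) = emeasure M (\<Union>m. T -` (E \<inter> nonbase m) \<inter> X)" by simp
  also have "\<dots> = (SUP m. emeasure M (T -` (E \<inter> nonbase m) \<inter> X))"
    using T_vimage_nonbase(1)[OF assms] inc by (intro SUP_emeasure_incseq[symmetric]) auto
  also have "\<dots> = (SUP m. emeasure M (E \<inter> nonbase m))"
    using T_vimage_nonbase(2)[OF assms] by simp
  also have "\<dots> = emeasure M (\<Union>m. E \<inter> nonbase m)"
    using assms nb inc by (intro SUP_emeasure_incseq) auto
  \<comment> \<open>Only the null set {0} can be missing from the union.\<close>
  also have "\<dots> = emeasure M ((\<Union>m. E \<inter> nonbase m) \<union> {0} \<inter> E)"
    using 0 assms nb by (intro emeasure_Un_null_set[symmetric] null_set_Int2) auto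
  also have "(\<Union>m. E \<inter> nonbase m) \<union> {0} \<inter> E = E"
    using UN_nonbase assms sets_M by blast
  finally show ?thesis .
qed

abbreviation "Tk \<equiv> prod_map k T"

lemma space_P: "space P = PiE {..<k} (\<lambda>_. X)"
  by (simp add: space_PiM)

lemma Tk_measurable: "Tk \<in> P \<rightarrow>\<^sub>M P"
  unfolding prod_map_def using T_measurable by measurable

lemma Tk_distr: "distr P P Tk = P"
proof (rule PM.PiM_eqI)
  fix A assume A: "\<And>i. i \<in> {..<k} \<Longrightarrow> A i \<in> sets M"
  have "Tk -` PiE {..<k} A \<inter> space P = PiE {..<k} (\<lambda>i. T -` A i \<inter> X)"
    unfolding space_P prod_map_def PiE_iff by auto
  moreover have "emeasure P (PiE {..<k} (\<lambda>i. T -` A i \<inter> X)) = (\<Prod>i<k. emeasure M (T -` A i \<inter> X))"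
    using measurable_sets[OF T_measurable A] by (intro PM.emeasure_PiM) auto
  ultimately show "emeasure (distr P P Tk) (PiE {..<k} A) = (\<Prod>i<k. emeasure M (A i))"
    using A by (simp add: emeasure_distr[OF Tk_measurable] sets_PiM_I_finite T_measure_preserving)
qed auto

lemma Tk_measure_preserving:
  "B \<in> sets P \<Longrightarrow> emeasure P (Tk -` B \<inter> space P) = emeasure P B"
  using emeasure_distr[OF Tk_measurable, of B] by (simp add: Tk_distr)

section \<open>Cubes of levels and their subdivision\<close>

definition "cube m p = PiE {..<k} (\<lambda>c. Level m (p c))"

text \<open>Vectors are arbitrary functions of which only the values below \<open>k\<close> matter;
  hence the recurring appeals to \<open>cube_cong\<close>.\<close>

definition "valid m p \<longleftrightarrow> (\<forall>c<k. p c < h m)" for p :: "nat \<Rightarrow> nat"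

lemma cube_cong: "(\<And>c. c < k \<Longrightarrow> p c = q c) \<Longrightarrow> cube m p = cube m q"
  unfolding cube_def by (rule PiE_cong) auto

lemma cube_sets: "valid m p \<Longrightarrow> cube m p \<in> sets P"
  unfolding cube_def valid_def by (intro sets_PiM_I_finite) auto

lemma emeasure_cube: "valid m p \<Longrightarrow> emeasure P (cube m p) = ennreal (w m ^ k)"
  unfolding cube_def valid_def
  by (subst PM.emeasure_PiM) (auto simp: emeasure_Level ennreal_power less_imp_le)

lemma cube_disjoint:
  assumes "x \<in> cube m p" "x \<in> cube m q" "valid m p" "valid m q" "c < k"
  shows "p c = q c"
  using assms Level_disjoint[of "x c" m "p c" "q c"] by (auto simp: cube_def valid_def PiE_iff)

lemma Tk_vimage_cube:
  assumes "valid m (\<lambda>c. Suc (p c))"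
  shows "Tk -` cube m (\<lambda>c. Suc (p c)) \<inter> space P = cube m p"
proof -
  have bwd: "x \<in> Level m (p c)" if "c < k" "x \<in> X" "T x \<in> Level m (Suc (p c))" for c x
    using T_vimage_Level[of "p c" m UNIV] assms that unfolding valid_def by blast
  have fwd: "x \<in> X \<and> T x \<in> Level m (Suc (p c))" if "c < k" "x \<in> Level m (p c)" for c x
    using T_vimage_Level[of "p c" m UNIV] assms that unfolding valid_def by blast
  show ?thesis
  proof (intro equalityI subsetI)
    fix x assume "x \<in> Tk -` cube m (\<lambda>c. Suc (p c)) \<inter> space P"
    then show "x \<in> cube m p" using bwd
      by (simp add: cube_def space_P prod_map_def PiE_iff)
  next
    fix x assume "x \<in> cube m p"
    then show "x \<in> Tk -` cube m (\<lambda>c. Suc (p c)) \<inter> space P" using fwd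
      by (simp add: cube_def space_P prod_map_def PiE_iff)
  qed
qed

text \<open>A digit vector selects a subcolumn for each coordinate. Unlike level vectors it is
  extensional, so that digit vectors can be counted and summed over.\<close>

definition "digits m = PiE {..<k} (\<lambda>_. {..<R m})"

lemma finite_digits [simp]: "finite (digits m)"
  by (simp add: digits_def finite_PiE)

lemma card_digits: "card (digits m) = R m ^ k"
  by (simp add: digits_def card_PiE)

definition "child m i p = (\<lambda>c. H m (i c) + p c)" for i p :: "nat \<Rightarrow> nat"

lemma valid_child: "valid m p \<Longrightarrow> i \<in> digits m \<Longrightarrow> valid (Suc m) (child m i p)"
proof -
  assume *: "valid m p" "i \<in> digits m"
  have "H m (i c) + p c < h (Suc m)" if "c < k" for c
  proof -
    have "i c < R m" "p c < h m" using * that by (auto simp: valid_def digits_def PiE_iff)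
    then show ?thesis using H_add_lt[of "i c" m "p c"] by simp
  qed
  then show ?thesis by (simp add: valid_def child_def)
qed

lemma cube_Suc:
  assumes "valid m p"
  shows "cube m p = (\<Union>i\<in>digits m. cube (Suc m) (child m i p))"
proof
  show "cube m p \<subseteq> (\<Union>i\<in>digits m. cube (Suc m) (child m i p))"
  proof
    fix x assume x: "x \<in> cube m p"
    then have "\<forall>c\<in>{..<k}. \<exists>i<R m. x c \<in> Level (Suc m) (H m i + p c)"
      using assms Level_Suc_cover by (auto simp: cube_def valid_def PiE_iff)
    then obtain i where i: "\<forall>c\<in>{..<k}. i c < R m \<and> x c \<in> Level (Suc m) (H m (i c) + p c)"
      by metis
    then have "restrict i {..<k} \<in> digits m" "x \<in> cube (Suc m) (child m (restrict i {..<k}) p)"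
      using x by (auto simp: digits_def cube_def child_def PiE_iff)
    then show "x \<in> (\<Union>i\<in>digits m. cube (Suc m) (child m i p))" by blast
  qed
  show "(\<Union>i\<in>digits m. cube (Suc m) (child m i p)) \<subseteq> cube m p"
  proof (rule UN_least)
    fix i assume "i \<in> digits m"
    then show "cube (Suc m) (child m i p) \<subseteq> cube m p"
      unfolding cube_def child_def using assms
      by (intro PiE_mono Level_Suc_subset) (auto simp: digits_def valid_def)
  qed
qed

lemma child_inj:
  assumes "valid m p" "valid m q" "i \<in> digits m" "j \<in> digits m"
    and "\<And>c. c < k \<Longrightarrow> child m i p c = child m j q c"
  shows "i = j" "\<And>c. c < k \<Longrightarrow> p c = q c"
proof -
  have *: "i c = j c \<and> p c = q c" if "c < k" for c
    using H_add_inj[of m "i c" "p c" "j c" "q c"] assms that by (auto simp: child_def valid_def)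
  then show "\<And>c. c < k \<Longrightarrow> p c = q c" by blast
  show "i = j"
    using * assms(3,4) unfolding digits_def by (intro PiE_ext[of i "{..<k}" "\<lambda>_. {..<R m}" j]) auto
qed

text \<open>The maximum of the thresholds of the k coordinates serves for all of them. The
  \<open>Suc\<close> guarantees that the image under \<open>Tk\<close> still lies in a cube of the
  same column.\<close>

lemma ex_cube:
  assumes "x \<in> space P"
  obtains n where "\<And>m. n \<le> m \<Longrightarrow> \<exists>p. valid m (\<lambda>c. Suc (p c)) \<and> x \<in> cube m p"
proof -
  have "\<forall>c\<in>{..<k}. \<exists>n. \<forall>m\<ge>n. \<exists>j. Suc j < h m \<and> x c \<in> Level m j"
    using assms ex_Level_nontop unfolding space_P PiE_iff by metis
  then obtain n where n: "\<And>c m. c < k \<Longrightarrow> n c \<le> m \<Longrightarrow> \<exists>j. Suc j < h m \<and> x c \<in> Level m j"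
    by (metis lessThan_iff)
  have "\<exists>p. valid m (\<lambda>c. Suc (p c)) \<and> x \<in> cube m p" if m: "Max (n ` {..<k}) \<le> m" for m
  proof -
    have "\<forall>c\<in>{..<k}. \<exists>j. Suc j < h m \<and> x c \<in> Level m j"
    proof
      fix c assume "c \<in> {..<k}"
      then have "n c \<le> Max (n ` {..<k})" "c < k" by (auto intro: Max_ge)
      then show "\<exists>j. Suc j < h m \<and> x c \<in> Level m j" using n[of c m] m order_trans by blast
    qed
    then obtain p where "\<forall>c\<in>{..<k}. Suc (p c) < h m \<and> x c \<in> Level m (p c)" by metis
    then show ?thesis using assms
      by (intro exI[of _ p]) (auto simp: valid_def cube_def space_P PiE_iff)
  qed
  then show thesis using that by blast
qed

section \<open>Divergent series\<close>

lemma R_mono: "i \<le> j \<Longrightarrow> R i \<le> R j"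
  by (rule lift_Suc_mono_le[of R]) (use r_Suc_ge in \<open>auto simp: R_def\<close>)

text \<open>Stages with a given tuple recur periodically, with period a power of 2. As
  \<open>R\<close> is nondecreasing, the term at n + N is bounded by the term at such a stage among
  the N indices after n, so summability along these stages would give summability of the whole
  series.\<close>

lemma not_summable_on_stages:
  assumes "us \<in> VL L" "\<not> summable (\<lambda>i. (1 / real (R i)) ^ k)"
  shows "\<not> summable (\<lambda>i. if U i = us then (1 / real (R i)) ^ k else 0)"
proof
  define \<rho> where "\<rho> i = (1 / real (R i)) ^ k" for i
  define x where "x i = (if U i = us then \<rho> i else 0)" for i
  assume "summable (\<lambda>i. if U i = us then (1 / real (R i)) ^ k else 0)"
  then have sx: "summable x" unfolding x_def[abs_def] \<rho>_def .
  have "us \<in> v ` {1..}"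
    using assms(1) unfolding bij_betw_imp_surj_on[OF bij_v] .
  then obtain J where J: "1 \<le> J" "v J = us" by auto
  define N where "N = (2::nat) ^ J"
  define a where "a = (2::nat) ^ (J - 1)"
  have N: "N = 2 * a" "0 < a" using J by (cases J; simp add: N_def a_def)+
  have x0: "0 \<le> x i" for i by (simp add: x_def \<rho>_def)
  have \<rho>: "\<rho> (n + N) \<le> (\<Sum>s<N. x (n + (1 + s)))" for n
  proof -
    \<comment> \<open>The offset that brings n + 2 + f to residue \<open>a\<close>; the added
      multiple of \<open>N\<close> keeps the subtraction from truncating.\<close>
    define f where "f = (a + N * (n + 2) - (n + 2)) mod N"
    have f: "f < N" using N by (simp add: f_def)
    have "1 * (n + 2) \<le> N * (n + 2)" using N by (intro mult_right_mono) auto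
    then have "n + 2 \<le> N * (n + 2)" by simp
    then have "n + 2 + (a + N * (n + 2) - (n + 2)) = a + N * (n + 2)" by linarith
    then have "(n + 2 + f) mod N = (a + N * (n + 2)) mod N"
      unfolding f_def mod_add_right_eq by (rule arg_cong)
    also have "\<dots> = a" using N by simp
    finally have md: "Suc (n + (1 + f)) mod N = a" by simp
    \<comment> \<open>Residue 2^(J-1) modulo 2^J means 2-adic valuation J - 1, for which
      \<open>sseq\<close> returns \<open>v J\<close>.\<close>
    have "\<not> N dvd Suc (n + (1 + f))" using md N by (auto simp: dvd_eq_mod_eq_0)
    moreover have "a dvd Suc (n + (1 + f))"
    proof -
      have "Suc (n + (1 + f)) mod N mod a = 0" using md by simp
      then show ?thesis unfolding N by (simp add: mod_mod_cancel dvd_eq_mod_eq_0)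
    qed
    ultimately have "val2 (Suc (n + (1 + f))) = J - 1"
      using J by (intro val2_eqI) (auto simp: N_def a_def)
    then have "U (n + (1 + f)) = us" using J by (simp add: U_def sseq_def)
    then have "x (n + (1 + f)) = \<rho> (n + (1 + f))" by (simp add: x_def)
    moreover have "\<rho> (n + N) \<le> \<rho> (n + (1 + f))"
      unfolding \<rho>_def using R_mono[of "n + (1 + f)" "n + N"] f R_ge_2[of "n + (1 + f)"]
      by (intro power_mono divide_left_mono) auto
    moreover have "x (n + (1 + f)) \<le> (\<Sum>s<N. x (n + (1 + s)))"
      using f x0 by (intro member_le_sum[of f _ "\<lambda>s. x (n + (1 + s))"]) auto
    ultimately show ?thesis by simp
  qed
  have "summable (\<lambda>n. \<Sum>s<N. x (n + (1 + s)))"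
    using sx by (intro summable_sum) (simp only: summable_iff_shift)
  then have "summable (\<lambda>n. \<rho> (n + N))"
    by (rule summable_comparison_test'[where N=0]) (use \<rho> in \<open>auto simp: \<rho>_def\<close>)
  then have "summable \<rho>" by (simp only: summable_iff_shift)
  then show False using assms(2) by (simp add: \<rho>_def[abs_def])
qed

lemma fmeasurable_cube: "valid m p \<Longrightarrow> cube m p \<in> fmeasurable P"
  by (intro fmeasurableI cube_sets) (simp_all add: emeasure_cube)

lemma w_Suc_power: "real (R m ^ k) * w (Suc m) ^ k = w m ^ k"
  using R_ge_2[of m] by (simp add: w_Suc power_divide)

section \<open>Densities of an invariant set in cubes\<close>

context
  fixes A assumes A_sets: "A \<in> sets P" and A_inv: "Tk -` A \<inter> space P = A"
begin

definition "\<alpha> m p = measure P (A \<inter> cube m p)"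

lemma fmeasurable_A_cube: "valid m p \<Longrightarrow> A \<inter> cube m p \<in> fmeasurable P"
  using fmeasurable_Int_fmeasurable[OF fmeasurable_cube A_sets] by (simp add: Int_commute)

lemma \<alpha>_le: "valid m p \<Longrightarrow> \<alpha> m p \<le> w m ^ k"
proof -
  assume "valid m p"
  then have "\<alpha> m p \<le> measure P (cube m p)" unfolding \<alpha>_def
    using A_sets cube_sets fmeasurable_cube by (intro measure_mono_fmeasurable) auto
  also have "\<dots> = w m ^ k" using \<open>valid m p\<close> by (simp add: measure_def emeasure_cube less_imp_le)
  finally show ?thesis .
qed

lemma \<alpha>_cong: "(\<And>c. c < k \<Longrightarrow> p c = q c) \<Longrightarrow> \<alpha> m p = \<alpha> m q"
  unfolding \<alpha>_def using cube_cong[of p q m] by simp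

text \<open>One step of \<open>Tk\<close> raises all coordinates of a cube by 1; it preserves both
  \<open>A\<close> and the measure.\<close>

lemma \<alpha>_shift: "valid m (\<lambda>c. p c + s) \<Longrightarrow> \<alpha> m (\<lambda>c. p c + s) = \<alpha> m p"
proof (induction s)
  case (Suc s)
  then have v: "valid m (\<lambda>c. Suc (p c + s))" by simp
  then have v': "valid m (\<lambda>c. p c + s)" by (auto simp: valid_def dest: Suc_lessD)
  have "emeasure P (Tk -` (A \<inter> cube m (\<lambda>c. Suc (p c + s))) \<inter> space P) =
     emeasure P (A \<inter> cube m (\<lambda>c. Suc (p c + s)))"
    using A_sets cube_sets[OF v] by (intro Tk_measure_preserving) auto
  moreover have "Tk -` (A \<inter> cube m (\<lambda>c. Suc (p c + s))) \<inter> space P = A \<inter> cube m (\<lambda>c. p c + s)"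
    using A_inv Tk_vimage_cube[OF v] by blast
  ultimately show ?case using Suc.IH[OF v'] by (simp add: \<alpha>_def measure_def)
qed simp

lemma \<alpha>_diff_const:
  assumes "valid m p" "valid m q" "\<And>c. c < k \<Longrightarrow> int (p c) - int (q c) = z"
  shows "\<alpha> m p = \<alpha> m q"
proof -
  have *: "\<alpha> m p = \<alpha> m q"
    if v: "valid m p" and z: "\<And>c. c < k \<Longrightarrow> int (p c) - int (q c) = z" "0 \<le> z" for p q z
  proof -
    have eq: "p c = q c + nat z" if "c < k" for c using z(1)[OF that] z(2) by linarith
    then have "valid m (\<lambda>c. q c + nat z)" using v by (simp add: valid_def)
    then have "\<alpha> m (\<lambda>c. q c + nat z) = \<alpha> m q" by (rule \<alpha>_shift)
    then show ?thesis using \<alpha>_cong[of p "\<lambda>c. q c + nat z" m] eq by simp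
  qed
  show ?thesis
  proof (cases "0 \<le> z")
    case True then show ?thesis using *[of p q z] assms by blast
  next
    case False
    have "int (q c) - int (p c) = - z" if "c < k" for c using assms(3)[OF that] by simp
    then show ?thesis using *[of q p "- z"] assms(2) False by simp
  qed
qed

lemma \<alpha>_Suc:
  assumes "valid m p"
  shows "\<alpha> m p = (\<Sum>i\<in>digits m. \<alpha> (Suc m) (child m i p))"
proof -
  have "A \<inter> cube m p = (\<Union>i\<in>digits m. A \<inter> cube (Suc m) (child m i p))"
    using cube_Suc[OF assms] by blast
  moreover have "measure P (\<Union>i\<in>digits m. A \<inter> cube (Suc m) (child m i p)) =
     (\<Sum>i\<in>digits m. measure P (A \<inter> cube (Suc m) (child m i p)))"
  proof (rule measure_finite_Union)
    show "(\<lambda>i. A \<inter> cube (Suc m) (child m i p)) ` digits m \<subseteq> sets P"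
      using fmeasurable_A_cube[OF valid_child[OF assms]] by auto
    show "disjoint_family_on (\<lambda>i. A \<inter> cube (Suc m) (child m i p)) (digits m)"
      unfolding disjoint_family_on_def
    proof (intro ballI impI, rule ccontr)
      fix i j assume ij: "i \<in> digits m" "j \<in> digits m" "i \<noteq> j"
        "A \<inter> cube (Suc m) (child m i p) \<inter> (A \<inter> cube (Suc m) (child m j p)) \<noteq> {}"
      then obtain x where "x \<in> cube (Suc m) (child m i p)" "x \<in> cube (Suc m) (child m j p)" by blast
      then have "child m i p c = child m j p c" if "c < k" for c
        using cube_disjoint valid_child[OF assms] ij that by blast
      then show False using child_inj(1)[OF assms assms ij(1,2)] ij(3) by blast
    qed
    show "emeasure P (A \<inter> cube (Suc m) (child m i p)) \<noteq> \<infinity>" if "i \<in> digits m" for i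
      using fmeasurableD2[OF fmeasurable_A_cube[OF valid_child[OF assms that]]] by simp
  qed simp
  ultimately show ?thesis by (simp add: \<alpha>_def)
qed

text \<open>The bound D e \<le> \<delta> of the overview for the single column \<open>m\<close>;
  \<open>z\<close> is the free common translation. The inequality is one-sided, since exchanging
  \<open>p\<close> and \<open>q\<close> replaces \<open>e\<close> by its negative.\<close>

definition "bounded_diff m e \<delta> \<longleftrightarrow> (\<forall>p q z. valid m p \<longrightarrow> valid m q \<longrightarrow>
   (\<forall>c<k. int (p c) - int (q c) = e c + z) \<longrightarrow> \<alpha> m p - \<alpha> m q \<le> \<delta> * w m ^ k)"

lemma bounded_diffD:
  "bounded_diff m e \<delta> \<Longrightarrow> valid m p \<Longrightarrow> valid m q \<Longrightarrow>
   (\<And>c. c < k \<Longrightarrow> int (p c) - int (q c) = e c + z) \<Longrightarrow> \<alpha> m p - \<alpha> m q \<le> \<delta> * w m ^ k"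
  unfolding bounded_diff_def by blast

lemma bounded_diff_ge_1: "1 \<le> \<delta> \<Longrightarrow> bounded_diff m e \<delta>"
  unfolding bounded_diff_def
proof (intro allI impI)
  fix p q assume "1 \<le> \<delta>" "valid m p"
  have "\<alpha> m p - \<alpha> m q \<le> \<alpha> m p" by (simp add: \<alpha>_def)
  also have "\<dots> \<le> 1 * w m ^ k" using \<alpha>_le[OF \<open>valid m p\<close>] by simp
  also have "\<dots> \<le> \<delta> * w m ^ k" using \<open>1 \<le> \<delta>\<close> by (intro mult_right_mono) (auto simp: less_imp_le)
  finally show "\<alpha> m p - \<alpha> m q \<le> \<delta> * w m ^ k" .
qed

text \<open>Giving both cubes the same digits preserves the difference of their vectors, so the
  bound for the subcubes is summed.\<close>

lemma bounded_diff_pred: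
  assumes "bounded_diff (Suc m) e \<delta>"
  shows "bounded_diff m e \<delta>"
  unfolding bounded_diff_def
proof (intro allI impI)
  fix p q z assume p: "valid m p" and q: "valid m q"
    and e: "\<forall>c<k. int (p c) - int (q c) = e c + z"
  have "\<alpha> m p - \<alpha> m q =
      (\<Sum>i\<in>digits m. \<alpha> (Suc m) (child m i p) - \<alpha> (Suc m) (child m i q))"
    by (simp add: \<alpha>_Suc[OF p] \<alpha>_Suc[OF q] sum_subtractf)
  also have "\<dots> \<le> (\<Sum>i\<in>digits m. \<delta> * w (Suc m) ^ k)"
    using e by (intro sum_mono bounded_diffD[OF assms, where z=z] valid_child p q) (auto simp: child_def)
  also have "\<dots> = \<delta> * w m ^ k"
    using w_Suc_power[of m] by (simp add: card_digits)
  finally show "\<alpha> m p - \<alpha> m q \<le> \<delta> * w m ^ k" .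
qed

text \<open>The heights of the digit vectors \<open>D0\<close> and \<open>D1\<close> differ by \<open>e\<close> up to a constant, so of the four subcubes they
  select, two lie on the same orbit and cancel, while the other two have difference \<open>2 * e\<close>.\<close>
lemma bounded_diff_good:
  assumes "bounded_diff (Suc m) e \<gamma>" "bounded_diff (Suc m) (\<lambda>c. 2 * e c) \<delta>"
    and d: "\<And>c. c < k \<Longrightarrow> d c < L \<and> int (U m ! d c) = e c + y"
  shows "bounded_diff m e ((1 - 2 * (1 / real (R m)) ^ k) * \<gamma> + (1 / real (R m)) ^ k * \<delta>)"
  unfolding bounded_diff_def
proof (intro allI impI)
  fix p q z assume p: "valid m p" and q: "valid m q"
    and e: "\<forall>c<k. int (p c) - int (q c) = e c + z"
  define D0 where "D0 = (\<lambda>c\<in>{..<k}. b m + d c)"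
  define D1 where "D1 = (\<lambda>c\<in>{..<k}. b m + Suc (d c))"
  have D: "D0 \<in> digits m" "D1 \<in> digits m"
    using d by (fastforce simp: D0_def D1_def digits_def R_eq)+
  have "D0 0 \<noteq> D1 0" using k_gt_1 by (simp add: D0_def D1_def)
  then have ne: "D0 \<noteq> D1" by auto
  have H: "int (H m (D1 c)) = int (H m (D0 c)) + 2 * int (h m) + e c + y" if "c < k" for c
    using d[OF that] H_tail_Suc[of "d c" m] that by (simp add: D0_def D1_def)
  let ?\<alpha> = "\<lambda>i p. \<alpha> (Suc m) (child m i p)"
  let ?W = "w (Suc m) ^ k"
  let ?D = "digits m - {D0, D1}"
  \<comment> \<open>Going from \<open>D0\<close> to \<open>D1\<close> raises coordinate
    \<open>c\<close> by \<open>e c\<close> up to a constant, which is just the excess of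
    \<open>p\<close> over \<open>q\<close>. In the opposite pairing the two excesses add up.\<close>
  have "?\<alpha> D0 p = ?\<alpha> D1 q"
    using e H by (intro \<alpha>_diff_const[where z="z - y - 2 * int (h m)"] valid_child p q D) (auto simp: child_def)
  moreover have "?\<alpha> D1 p - ?\<alpha> D0 q \<le> \<delta> * ?W"
    using e H by (intro bounded_diffD[OF assms(2), where z="z + y + 2 * int (h m)"] valid_child p q D)
      (auto simp: child_def)
  moreover have "(\<Sum>i\<in>?D. ?\<alpha> i p - ?\<alpha> i q) \<le> (\<Sum>i\<in>?D. \<gamma> * ?W)"
    using e by (intro sum_mono bounded_diffD[OF assms(1), where z=z] valid_child p q) (auto simp: child_def)
  moreover have "\<alpha> m p - \<alpha> m q = (\<Sum>i\<in>?D. ?\<alpha> i p - ?\<alpha> i q) + (?\<alpha> D0 p - ?\<alpha> D0 q) + (?\<alpha> D1 p - ?\<alpha> D1 q)"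
  proof -
    have "\<alpha> m p - \<alpha> m q = (\<Sum>i\<in>digits m. ?\<alpha> i p - ?\<alpha> i q)"
      by (simp add: \<alpha>_Suc[OF p] \<alpha>_Suc[OF q] sum_subtractf)
    also have "\<dots> = (\<Sum>i\<in>?D. ?\<alpha> i p - ?\<alpha> i q) + (\<Sum>i\<in>{D0, D1}. ?\<alpha> i p - ?\<alpha> i q)"
      using D by (intro sum.subset_diff) auto
    finally show ?thesis using ne by simp
  qed
  ultimately have "\<alpha> m p - \<alpha> m q \<le> real (card ?D) * (\<gamma> * ?W) + \<delta> * ?W" by simp
  also have "real (card ?D) = real (R m ^ k) - 2"
  proof -
    have "card ?D = R m ^ k - 2" using D ne by (simp add: card_Diff_subset card_digits)
    moreover have "2 \<le> R m ^ k"
      using card_mono[of "digits m" "{D0, D1}"] D ne by (simp add: card_digits)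
    ultimately show ?thesis by simp
  qed
  also have "(real (R m ^ k) - 2) * (\<gamma> * ?W) + \<delta> * ?W =
     ((1 - 2 * (1 / real (R m)) ^ k) * \<gamma> + (1 / real (R m)) ^ k * \<delta>) * w m ^ k"
    using R_ge_2[of m] unfolding w_Suc_power[of m, symmetric] by (simp add: field_simps power_divide)
  finally show "\<alpha> m p - \<alpha> m q \<le>
     ((1 - 2 * (1 / real (R m)) ^ k) * \<gamma> + (1 / real (R m)) ^ k * \<delta>) * w m ^ k" .
qed

text \<open>The value \<delta>/2 is the fixed point of the recursion in
  \<open>bounded_diff_good\<close>: with x = 2 (1/R)^k a bound \<delta>/2 + Q becomes \<delta>/2 +
  (1 - x) Q, and the product of the factors 1 - x tends to 0 by divergence.\<close>

lemma bounded_diff_halve: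
  assumes ns: "\<not> summable (\<lambda>i. (1 / real (R i)) ^ k)" and "0 \<le> \<delta>"
    and dbl: "\<And>m. bounded_diff m (\<lambda>c. 2 * e c) \<delta>"
  shows "bounded_diff m e (\<delta> / 2)"
proof -
  obtain us d y where us: "us \<in> VL L" "\<And>c. c < k \<Longrightarrow> d c < L \<and> int (us ! d c) = e c + y"
    using ex_strict_list_containing[OF k_le_L] by metis
  define x where "x i = 2 * (if U i = us then (1 / real (R i)) ^ k else 0)" for i
  have x0: "0 \<le> x i" for i by (simp add: x_def)
  have x1: "x i \<le> 1" for i
  proof -
    have "(1 / real (R i)) ^ k \<le> (1/2) ^ 1"
      using R_ge_2[of i] k_gt_1
      by (intro order_trans[OF power_mono[of "1 / real (R i)" "1/2"] power_decreasing])
        (auto intro!: divide_left_mono)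
    then show ?thesis by (simp add: x_def)
  qed
  have nx: "\<not> summable (\<lambda>i. x (i + m))"
    using not_summable_on_stages[OF us(1) ns] unfolding x_def
    by (subst summable_iff_shift[of "\<lambda>i. 2 * _ i"]) (simp add: summable_cmult_iff)
  \<comment> \<open>The recursion runs from column m + t, where the trivial bound 1 holds, down to
    column \<open>m\<close>.\<close>
  have bd: "bounded_diff m e (\<delta> / 2 + (\<Prod>j\<in>{m..<m + t}. 1 - x j))" for t m
  proof (induction t arbitrary: m)
    case 0
    then show ?case using \<open>0 \<le> \<delta>\<close> by (simp add: bounded_diff_ge_1)
  next
    case (Suc t)
    define Q where "Q = (\<Prod>j\<in>{Suc m..<Suc m + t}. 1 - x j)"
    have IH: "bounded_diff (Suc m) e (\<delta> / 2 + Q)" using Suc[of "Suc m"] by (simp add: Q_def)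
    have "{m..<m + Suc t} = insert m {Suc m..<Suc m + t}" by auto
    then have pr: "(\<Prod>j\<in>{m..<m + Suc t}. 1 - x j) = (1 - x m) * Q" by (simp add: Q_def)
    show ?case
    proof (cases "U m = us")
      case True
      show ?thesis
        using bounded_diff_good[OF IH dbl, of d y] us True unfolding pr
        by (simp add: x_def algebra_simps)
    next
      case False
      then show ?thesis using bounded_diff_pred[OF IH] unfolding pr by (simp add: x_def)
    qed
  qed
  show ?thesis unfolding bounded_diff_def
  proof (intro allI impI)
    fix p q z assume pq: "valid m p" "valid m q" "\<forall>c<k. int (p c) - int (q c) = e c + z"
    have "\<alpha> m p - \<alpha> m q \<le> \<delta> / 2 * w m ^ k + \<epsilon>" if "0 < \<epsilon>" for \<epsilon>
    proof -
      define \<epsilon>' where "\<epsilon>' = \<epsilon> / w m ^ k"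
      have "0 < \<epsilon>'" using that by (simp add: \<epsilon>'_def)
      \<comment> \<open>Nonnegative terms without a sum have unbounded partial sums; passing this
        threshold makes the product at most \<epsilon>'.\<close>
      have "\<exists>t. - ln \<epsilon>' < (\<Sum>i<t. x (i + m))"
      proof (rule ccontr)
        assume "\<not> ?thesis"
        then have "summable (\<lambda>i. x (i + m))"
          using x0 by (intro summableI_nonneg_bounded[where x="- ln \<epsilon>'"]) (auto simp: not_less)
        then show False using nx by blast
      qed
      then obtain t where t: "- ln \<epsilon>' < (\<Sum>i<t. x (i + m))" by blast
      have "(\<Sum>i<t. x (i + m)) = (\<Sum>j\<in>{m..<m + t}. x j)"
        by (rule sum.reindex_bij_witness[of _ "\<lambda>j. j - m" "\<lambda>i. i + m"]) auto
      with t have "exp (- (\<Sum>j\<in>{m..<m + t}. x j)) < exp (ln \<epsilon>')" by simp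
      then have "(\<Prod>j\<in>{m..<m + t}. 1 - x j) \<le> \<epsilon>'"
        using prod_one_minus_le_exp[of "{m..<m + t}" x] x1 \<open>0 < \<epsilon>'\<close> by simp
      then have "(\<delta> / 2 + (\<Prod>j\<in>{m..<m + t}. 1 - x j)) * w m ^ k \<le> (\<delta> / 2 + \<epsilon>') * w m ^ k"
        by (intro mult_right_mono) (auto simp: less_imp_le)
      also have "\<dots> = \<delta> / 2 * w m ^ k + \<epsilon>"
        using w_pos[of m] by (simp add: \<epsilon>'_def distrib_right del: w_pos)
      finally show ?thesis using bounded_diffD[OF bd[where t=t] pq(1,2), of z] pq(3) by fastforce
    qed
    then show "\<alpha> m p - \<alpha> m q \<le> \<delta> / 2 * w m ^ k" by (rule field_le_epsilon)
  qed
qed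

text \<open>The bound 1 holds for every difference vector, in particular for 2^n e; halving n times
  gives (1/2)^n for \<open>e\<close>, with \<open>e\<close> the actual difference of the two
  vectors.\<close>

lemma \<alpha>_const:
  assumes ns: "\<not> summable (\<lambda>i. (1 / real (R i)) ^ k)" and "valid m p" "valid m q"
  shows "\<alpha> m p = \<alpha> m q"
proof -
  have bd: "bounded_diff m e ((1/2) ^ n)" for n m e
  proof (induction n arbitrary: m e)
    case 0 show ?case by (simp add: bounded_diff_ge_1)
  next
    case (Suc n)
    show ?case using bounded_diff_halve[OF ns, of "(1/2)^n" e m] Suc by simp
  qed
  have "\<alpha> m p \<le> \<alpha> m q" if "valid m p" "valid m q" for p q
  proof -
    have "\<alpha> m p - \<alpha> m q \<le> (1/2) ^ n * w m ^ k" for n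
      by (rule bounded_diffD[OF bd[where e="\<lambda>c. int (p c) - int (q c)"] that, where z=0]) simp
    moreover have "(\<lambda>n. (1/2) ^ n * w m ^ k) \<longlonglongrightarrow> 0 * w m ^ k"
      by (intro tendsto_mult LIMSEQ_realpow_zero tendsto_const) auto
    ultimately have "\<alpha> m p - \<alpha> m q \<le> 0 * w m ^ k" by (intro LIMSEQ_le_const) auto
    then show ?thesis by simp
  qed
  then show ?thesis using assms by (simp add: order_antisym)
qed

text \<open>The initial column is a single cube of measure 1, and at each step all subcubes receive
  equal shares.\<close>

lemma \<alpha>_proportional:
  assumes ns: "\<not> summable (\<lambda>i. (1 / real (R i)) ^ k)" and "valid m p"
  shows "\<alpha> m p = \<alpha> 0 (\<lambda>_. 0) * w m ^ k"
  using assms(2)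
proof (induction m arbitrary: p)
  case 0
  then show ?case using \<alpha>_const[OF ns, of 0 p "\<lambda>_. 0"] by (simp add: valid_def wid_def)
next
  case (Suc m)
  have v0: "valid m (\<lambda>_. 0)" by (simp add: valid_def)
  have "\<alpha> 0 (\<lambda>_. 0) * w m ^ k = (\<Sum>i\<in>digits m. \<alpha> (Suc m) (child m i (\<lambda>_. 0)))"
    using Suc.IH[OF v0] \<alpha>_Suc[OF v0] by simp
  also have "\<dots> = (\<Sum>i\<in>digits m. \<alpha> (Suc m) p)"
    by (intro sum.cong refl \<alpha>_const[OF ns] valid_child v0 Suc.prems)
  also have "\<dots> = real (R m ^ k) * \<alpha> (Suc m) p" by (simp add: card_digits)
  finally have "real (R m ^ k) * \<alpha> (Suc m) p = real (R m ^ k) * (\<alpha> 0 (\<lambda>_. 0) * w (Suc m) ^ k)"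
    unfolding w_Suc_power[of m, symmetric] by (auto simp del: of_nat_power)
  moreover have "real (R m ^ k) \<noteq> 0" using R_ge_2[of m] by simp
  ultimately show ?case using mult_left_cancel by blast
qed

end

section \<open>Cubes determine a measure\<close>

lemma cube_subset_space: "valid m p \<Longrightarrow> cube m p \<subseteq> space P"
  using cube_sets sets.sets_into_space by blast

lemma cube_eq_UN:
  assumes "valid m p" "m \<le> n"
  shows "\<exists>Q. (\<forall>q\<in>Q. valid n q) \<and> cube m p = (\<Union>q\<in>Q. cube n q)"
  using assms(2)
proof (induction rule: dec_induct)
  case base
  then show ?case using assms by (intro exI[of _ "{p}"]) simp
next
  case (step n)
  then obtain Q where Q: "\<forall>q\<in>Q. valid n q" "cube m p = (\<Union>q\<in>Q. cube n q)" by blast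
  let ?Q = "(\<Union>q\<in>Q. (\<lambda>i. child n i q) ` digits n)"
  have "cube m p = (\<Union>q\<in>Q. \<Union>i\<in>digits n. cube (Suc n) (child n i q))"
    unfolding Q(2) using Q(1) cube_Suc by (intro SUP_cong) auto
  then have "cube m p = (\<Union>q\<in>?Q. cube (Suc n) q)" by simp
  moreover have "\<forall>q\<in>?Q. valid (Suc n) q" using Q(1) valid_child by auto
  ultimately show ?case by blast
qed

lemma cube_nested:
  assumes "valid m p" "valid n q" "m \<le> n" "cube m p \<inter> cube n q \<noteq> {}"
  shows "cube n q \<subseteq> cube m p"
proof -
  obtain Q where Q: "\<forall>q\<in>Q. valid n q" "cube m p = (\<Union>q\<in>Q. cube n q)"
    using cube_eq_UN[OF assms(1,3)] by auto
  obtain x q' where x: "x \<in> cube n q" "q' \<in> Q" "x \<in> cube n q'" using assms(4) Q(2) by blast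
  then have "cube n q = cube n q'"
    using cube_disjoint[OF x(1,3)] assms(2) Q(1) by (intro cube_cong) auto
  then show ?thesis using Q(2) x(2) by blast
qed

text \<open>Two cubes are nested or disjoint, so adding the empty set makes the family closed under
  intersection.\<close>

definition "cubes = insert {} {cube m p | m p. valid m p}"

lemma Int_stable_cubes: "Int_stable cubes"
  unfolding Int_stable_def
proof (intro ballI)
  fix a a' assume "a \<in> cubes" "a' \<in> cubes"
  then consider "a = {}" | "a' = {}" | m p n q where "a = cube m p" "a' = cube n q" "valid m p" "valid n q"
    unfolding cubes_def by blast
  then show "a \<inter> a' \<in> cubes"
  proof cases
    case (3 m p n q)
    then consider "a \<inter> a' = {}" | "a \<inter> a' = a" | "a \<inter> a' = a'"
      using cube_nested[of m p n q] cube_nested[of n q m p] linear[of m n] by blast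
    then show ?thesis using \<open>a \<in> cubes\<close> \<open>a' \<in> cubes\<close> by cases (auto simp: cubes_def)
  qed (auto simp: cubes_def)
qed

lemma cubes_sets: "cubes \<subseteq> sets P"
  unfolding cubes_def using cube_sets by auto

lemma cubes_subset: "cubes \<subseteq> Pow (space P)"
  using cubes_sets sets.sets_into_space by blast

lemma cube_restrict: "valid m p \<Longrightarrow> \<exists>q\<in>PiE {..<k} (\<lambda>_. {..<h m}). cube m p = cube m q"
  by (intro bexI[of _ "restrict p {..<k}"] cube_cong) (auto simp: valid_def)

lemma valid_PiE: "q \<in> PiE {..<k} (\<lambda>_. {..<h m}) \<Longrightarrow> valid m q"
  by (auto simp: valid_def PiE_iff)

lemma countable_cubes: "countable cubes"
proof -
  have "cubes \<subseteq> insert {} (\<Union>m. cube m ` PiE {..<k} (\<lambda>_. {..<h m}))"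
  proof
    fix a assume "a \<in> cubes"
    then consider "a = {}" | m p where "a = cube m p" "valid m p" unfolding cubes_def by blast
    then show "a \<in> insert {} (\<Union>m. cube m ` PiE {..<k} (\<lambda>_. {..<h m}))"
    proof cases
      case (2 m p)
      then have "a \<in> cube m ` PiE {..<k} (\<lambda>_. {..<h m})" using cube_restrict[of m p] by auto
      then show ?thesis by blast
    qed simp
  qed
  moreover have "countable \<dots>"
    by (intro countable_insert countable_UN countable_image) (auto intro: countable_finite finite_PiE)
  ultimately show ?thesis by (rule countable_subset)
qed

lemma Union_cubes: "\<Union>cubes = space P"
proof
  show "\<Union>cubes \<subseteq> space P" using cubes_subset by blast
  show "space P \<subseteq> \<Union>cubes"
  proof
    fix x assume "x \<in> space P"
    then obtain m where "\<exists>p. valid m (\<lambda>c. Suc (p c)) \<and> x \<in> cube m p"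
      using ex_cube by blast
    then obtain p where p: "valid m (\<lambda>c. Suc (p c))" "x \<in> cube m p" by blast
    then have "valid m p" by (auto simp: valid_def dest: Suc_lessD)
    then show "x \<in> \<Union>cubes" using p unfolding cubes_def by blast
  qed
qed

text \<open>Widths tend to 0, so a half-space is the countable union of the cubes whose level in
  coordinate \<open>c\<close> lies inside it.\<close>

lemma coordinate_measurable_cubes:
  assumes "c < k"
  shows "(\<lambda>x. x c) \<in> borel_measurable (sigma (space P) cubes)"
proof (rule borel_measurableI_less)
  fix t :: real
  let ?Q = "\<lambda>m. {p \<in> PiE {..<k} (\<lambda>_. {..<h m}). Level m (p c) \<subseteq> {..<t}}"
  have "{x \<in> space P. x c < t} = (\<Union>m. \<Union>p\<in>?Q m. cube m p)"
  proof (intro equalityI subsetI)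
    fix x assume x: "x \<in> {x \<in> space P. x c < t}"
    obtain n where n: "\<And>m. n \<le> m \<Longrightarrow> \<exists>p. valid m (\<lambda>c. Suc (p c)) \<and> x \<in> cube m p"
      using ex_cube x by blast
    obtain m where m: "n \<le> m" "w m < t - x c" using w_small[of "t - x c"] x by auto
    obtain p where "valid m (\<lambda>c. Suc (p c))" "x \<in> cube m p" using n[OF m(1)] by blast
    moreover from this have "valid m p" by (auto simp: valid_def dest: Suc_lessD)
    ultimately obtain q where q: "q \<in> PiE {..<k} (\<lambda>_. {..<h m})" "x \<in> cube m q"
      using cube_restrict by blast
    then have "x c \<in> Level m (q c)" using assms by (auto simp: cube_def)
    then have "Level m (q c) \<subseteq> {..<t}" using m by (auto simp: Level_def)
    then show "x \<in> (\<Union>m. \<Union>p\<in>?Q m. cube m p)" using q by blast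
  next
    fix x assume "x \<in> (\<Union>m. \<Union>p\<in>?Q m. cube m p)"
    then obtain m p where p: "p \<in> PiE {..<k} (\<lambda>_. {..<h m})" "Level m (p c) \<subseteq> {..<t}" "x \<in> cube m p"
      by blast
    then have "x c \<in> Level m (p c)" "x \<in> space P"
      using assms subsetD[OF cube_subset_space[OF valid_PiE[OF p(1)]] p(3)] by (auto simp: cube_def)
    then show "x \<in> {x \<in> space P. x c < t}" using p by auto
  qed
  moreover have "(\<Union>m. \<Union>p\<in>?Q m. cube m p) \<in> sets (sigma (space P) cubes)"
  proof (rule sets.countable_UN''[OF countableI_type], rule sets.finite_UN)
    show "finite (?Q m)" for m
      by (rule finite_subset[of _ "PiE {..<k} (\<lambda>_. {..<h m})"]) (auto intro: finite_PiE)
    fix m p assume "p \<in> ?Q m"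
    then have "cube m p \<in> cubes" using valid_PiE unfolding cubes_def by blast
    then show "cube m p \<in> sets (sigma (space P) cubes)" using cubes_subset by auto
  qed
  ultimately show "{x \<in> space (sigma (space P) cubes). x c < t} \<in> sets (sigma (space P) cubes)"
    using cubes_subset by (simp add: space_measure_of)
qed

text \<open>The factors of \<open>P\<close> carry Lebesgue sets, while cubes are only shown to
  generate boxes of Borel sets. The assumption on null sets bridges this: equality passes from cubes
  to Borel boxes, then to boxes of Lebesgue sets, which generate the sets of
  \<open>P\<close>.\<close>

lemma measure_eq_on_cubes:
  assumes sets: "sets N1 = sets P" "sets N2 = sets P"
    and eq: "\<And>m p. valid m p \<Longrightarrow> emeasure N1 (cube m p) = emeasure N2 (cube m p)"
    and fin: "\<And>m p. valid m p \<Longrightarrow> emeasure N1 (cube m p) \<noteq> \<infinity>"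
    and null: "\<And>E. E \<in> null_sets P \<Longrightarrow> E \<in> null_sets N1 \<and> E \<in> null_sets N2"
  shows "N1 = N2"
proof -
  let ?G = "sigma (space P) cubes"
  have sets_G: "sets ?G = sigma_sets (space P) cubes" using cubes_subset by simp
  have sp: "space N1 = space P" "space N2 = space P"
    using sets by (auto dest: sets_eq_imp_space_eq)
  have meas: "(\<lambda>x. x) \<in> N1 \<rightarrow>\<^sub>M ?G" "(\<lambda>x. x) \<in> N2 \<rightarrow>\<^sub>M ?G"
    using cubes_subset cubes_sets sets sp
    by (auto intro!: measurable_measure_of simp: Int_absorb2 subset_eq)
  have dist: "distr N1 ?G (\<lambda>x. x) = distr N2 ?G (\<lambda>x. x)"
  proof (rule measure_eqI_generator_eq_countable[OF Int_stable_cubes cubes_subset])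
    fix E assume "E \<in> cubes"
    moreover from this have "E \<in> sets ?G" using cubes_subset by auto
    ultimately show "emeasure (distr N1 ?G (\<lambda>x. x)) E = emeasure (distr N2 ?G (\<lambda>x. x)) E"
      using eq meas cube_subset_space sp by (auto simp: emeasure_distr Int_absorb2 cubes_def[THEN eqset_imp_iff])
  next
    show "\<Union> cubes = space P" by (rule Union_cubes)
    fix E assume "E \<in> cubes"
    moreover from this have "E \<in> sets ?G" using cubes_subset by auto
    ultimately show "emeasure (distr N1 ?G (\<lambda>x. x)) E \<noteq> \<infinity>"
      using fin meas cube_subset_space sp by (auto simp: emeasure_distr Int_absorb2 cubes_def[THEN eqset_imp_iff])
  qed (auto simp: sets_G countable_cubes)
  have borel_box: "emeasure N1 (PiE {..<k} E) = emeasure N2 (PiE {..<k} E)"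
    if E: "\<And>c. c < k \<Longrightarrow> E c \<in> sets borel \<and> E c \<subseteq> X" for E
  proof -
    have "PiE {..<k} E = (\<Inter>c\<in>{..<k}. (\<lambda>x. x c) -` E c \<inter> space ?G)"
    proof (intro equalityI subsetI)
      fix x assume x: "x \<in> PiE {..<k} E"
      then have "x \<in> space P" using E by (auto simp: space_P PiE_iff)
      then show "x \<in> (\<Inter>c\<in>{..<k}. (\<lambda>x. x c) -` E c \<inter> space ?G)"
        using x by (auto simp: space_measure_of_conv PiE_iff)
    next
      fix x assume x: "x \<in> (\<Inter>c\<in>{..<k}. (\<lambda>x. x c) -` E c \<inter> space ?G)"
      moreover have "0 \<in> {..<k}" using k_gt_1 by simp
      ultimately have "x \<in> space P" unfolding space_measure_of_conv by blast
      moreover have "x c \<in> E c" if "c < k" for c using x that by blast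
      ultimately show "x \<in> PiE {..<k} E" by (auto simp: space_P PiE_iff)
    qed
    also have "\<dots> \<in> sets ?G"
      using k_gt_1 E coordinate_measurable_cubes by (intro sets.finite_INT measurable_sets) (auto simp: lessThan_empty_iff)
    finally have G: "PiE {..<k} E \<in> sets ?G" .
    have "PiE {..<k} E \<subseteq> space P" using E by (auto simp: space_P PiE_iff)
    then have "emeasure (distr N1 ?G (\<lambda>x. x)) (PiE {..<k} E) = emeasure N1 (PiE {..<k} E)"
      "emeasure (distr N2 ?G (\<lambda>x. x)) (PiE {..<k} E) = emeasure N2 (PiE {..<k} E)"
      using G meas sp by (auto simp: emeasure_distr Int_absorb2)
    then show ?thesis using dist by simp
  qed
  have box: "emeasure N1 (PiE {..<k} E) = emeasure N2 (PiE {..<k} E)"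
    if E: "\<And>c. c < k \<Longrightarrow> E c \<in> sets M" for E
  proof -
    \<comment> \<open>Each Lebesgue side is a Borel set up to a null set.\<close>
    have "\<exists>B N. B \<in> sets borel \<and> N \<in> null_sets M \<and> B \<union> N = E c" if "c < k" for c
    proof -
      have "E c \<in> sets lebesgue" using E[OF that] by (simp add: sets_M)
      then obtain B N where BN: "B \<in> sets borel" "negligible N" "B \<union> N = E c"
        using sets_lebesgue_almost_borel by blast
      then have "N \<in> null_sets lebesgue" by (simp add: negligible_iff_null_sets)
      moreover have "N \<subseteq> X" using BN E[OF that] by (auto simp: sets_M)
      ultimately have "N \<in> sets M" by (auto simp: sets_M)
      then have "N \<in> null_sets M" using \<open>N \<in> null_sets lebesgue\<close> by (simp add: null_sets_def emeasure_M)
      then show ?thesis using BN by blast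
    qed
    then obtain B N where BN: "\<And>c. c < k \<Longrightarrow> B c \<in> sets borel \<and> N c \<in> null_sets M \<and> B c \<union> N c = E c"
      by metis
    have BX: "B c \<in> sets borel \<and> B c \<subseteq> X" if "c < k" for c
      using BN[OF that] E[OF that] sets_M by blast
    \<comment> \<open>Points whose coordinate \<open>c\<close> falls into the null part of side
      \<open>c\<close>; outside the union of these sets the two boxes coincide.\<close>
    let ?Z = "\<lambda>c. PiE {..<k} ((\<lambda>_. X)(c := N c))"
    have Z: "?Z c \<in> null_sets P" if "c < k" for c
    proof -
      have s: "((\<lambda>_. X)(c := N c)) i \<in> sets M" for i using BN[OF that] sets.top[of M] by auto
      then have "emeasure P (?Z c) = (\<Prod>i<k. emeasure M (((\<lambda>_. X)(c := N c)) i))"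
        by (intro PM.emeasure_PiM) auto
      also have "\<dots> = 0" using that BN[OF that] by (intro prod_zero) auto
      finally have "emeasure P (?Z c) = 0" .
      moreover have "?Z c \<in> sets P" using s by (intro sets_PiM_I_finite) auto
      ultimately show ?thesis by (simp add: null_sets_def)
    qed
    have ae: "AE x in Q. x \<in> PiE {..<k} E \<longleftrightarrow> x \<in> PiE {..<k} B"
      if Q: "sets Q = sets P" "\<And>E. E \<in> null_sets P \<Longrightarrow> E \<in> null_sets Q" for Q :: "(nat \<Rightarrow> real) measure"
    proof (rule AE_I')
      show "(\<Union>c\<in>{..<k}. ?Z c) \<in> null_sets Q"
        using Z Q(2) by (intro null_sets.finite_UN) auto
      show "{x \<in> space Q. \<not> (x \<in> PiE {..<k} E \<longleftrightarrow> x \<in> PiE {..<k} B)} \<subseteq> (\<Union>c\<in>{..<k}. ?Z c)"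
      proof
        fix x assume "x \<in> {x \<in> space Q. \<not> (x \<in> PiE {..<k} E \<longleftrightarrow> x \<in> PiE {..<k} B)}"
        then have x: "x \<in> space P" "\<not> (x \<in> PiE {..<k} E \<longleftrightarrow> x \<in> PiE {..<k} B)"
          using sets_eq_imp_space_eq[OF Q(1)] by auto
        have "PiE {..<k} B \<subseteq> PiE {..<k} E" using BN by (intro PiE_mono) auto
        then have "x \<in> PiE {..<k} E" "x \<notin> PiE {..<k} B" using x(2) by auto
        then obtain c where "c < k" "x c \<in> E c" "x c \<notin> B c"
          unfolding PiE_iff by blast
        then have "c < k" "x c \<in> N c" using BN by auto
        then show "x \<in> (\<Union>c\<in>{..<k}. ?Z c)" using x(1) by (auto simp: space_P PiE_iff intro!: bexI[of _ c])
      qed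
    qed
    have "PiE {..<k} E \<in> sets P" "PiE {..<k} B \<in> sets P"
      using E BX by (auto intro!: sets_PiM_I_finite simp: sets_M)
    then have E_B: "emeasure Q (PiE {..<k} E) = emeasure Q (PiE {..<k} B)"
      if "sets Q = sets P" "\<And>E. E \<in> null_sets P \<Longrightarrow> E \<in> null_sets Q" for Q :: "(nat \<Rightarrow> real) measure"
      using ae[OF that] that(1) by (intro emeasure_eq_AE) auto
    have "emeasure N1 (PiE {..<k} E) = emeasure N1 (PiE {..<k} B)"
      by (rule E_B[OF sets(1)]) (use null in blast)
    also have "\<dots> = emeasure N2 (PiE {..<k} B)" by (rule borel_box[OF BX])
    also have "\<dots> = emeasure N2 (PiE {..<k} E)"
      by (rule E_B[OF sets(2), symmetric]) (use null in blast)
    finally show ?thesis .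
  qed
  show ?thesis
  proof (rule measure_eqI_generator_eq_countable[where A="cubes" and E="prod_algebra {..<k} (\<lambda>_. M)"])
    show "sets N1 = sigma_sets (PiE {..<k} (\<lambda>_. space M)) (prod_algebra {..<k} (\<lambda>_. M))"
      "sets N2 = sigma_sets (PiE {..<k} (\<lambda>_. space M)) (prod_algebra {..<k} (\<lambda>_. M))"
      using sets by (simp_all add: sets_PiM)
    show "\<Union> cubes = PiE {..<k} (\<lambda>_. space M)" by (simp add: Union_cubes space_P)
    show "cubes \<subseteq> prod_algebra {..<k} (\<lambda>_. M)"
    proof
      fix E assume "E \<in> cubes"
      then consider "E = {}" | m p where "E = cube m p" "valid m p" unfolding cubes_def by blast
      then show "E \<in> prod_algebra {..<k} (\<lambda>_. M)"
      proof cases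
        case 1
        have "PiE {..<k} (\<lambda>_. {}) = ({} :: (nat \<Rightarrow> real) set)" using k_gt_1 by (auto simp: PiE_eq_empty_iff)
        moreover have "PiE {..<k} (\<lambda>_. {}) \<in> prod_algebra {..<k} (\<lambda>_. M)"
          by (intro prod_algebraI_finite) auto
        ultimately show ?thesis using 1 by simp
      next
        case 2
        then show ?thesis unfolding cube_def valid_def by (auto intro!: prod_algebraI_finite)
      qed
    qed
    fix E assume "E \<in> prod_algebra {..<k} (\<lambda>_. M)"
    then obtain E' where "E = PiE {..<k} E'" "E' \<in> (\<Pi> j\<in>{..<k}. sets M)"
      by (auto simp: prod_algebra_eq_finite)
    then show "emeasure N1 E = emeasure N2 E"
      using box[of E'] by (simp add: Pi_iff)
  next
    fix E assume "E \<in> cubes"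
    then show "emeasure N1 E \<noteq> \<infinity>" using fin by (auto simp: cubes_def)
  qed (rule Int_stable_prod_algebra prod_algebra_sets_into_space countable_cubes)+
qed

theorem ergodic_if_not_summable:
  assumes ns: "\<not> summable (\<lambda>i. (1 / real (R i)) ^ k)"
  shows "ergodic P Tk"
  unfolding ergodic_def
proof (intro conjI ballI impI)
  show "Tk \<in> P \<rightarrow>\<^sub>M P" by (rule Tk_measurable)
  fix A assume A: "A \<in> sets P" and inv: "Tk -` A \<inter> space P = A"
  define \<kappa> where "\<kappa> = \<alpha> A 0 (\<lambda>_. 0)"
  have k0: "0 \<le> \<kappa>" by (simp add: \<kappa>_def \<alpha>_def[OF A inv])
  \<comment> \<open>The restriction of \<open>P\<close> to \<open>A\<close> and the multiple of
    \<open>P\<close> that agrees with it on every cube.\<close>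
  define N1 where "N1 = density P (indicator A)"
  define N2 where "N2 = density P (\<lambda>_. ennreal \<kappa>)"
  have N1: "emeasure N1 E = emeasure P (A \<inter> E)" if "E \<in> sets P" for E
    unfolding N1_def using A that by (rule emeasure_restricted)
  have N2: "emeasure N2 E = ennreal \<kappa> * emeasure P E" if "E \<in> sets P" for E
    using that by (simp add: N2_def emeasure_density_const)
  have "N1 = N2"
  proof (rule measure_eq_on_cubes)
    show "sets N1 = sets P" "sets N2 = sets P" by (simp_all add: N1_def N2_def)
    fix m p assume p: "valid m p"
    have "emeasure P (A \<inter> cube m p) = ennreal (\<alpha> A m p)"
      using fmeasurableD2[OF fmeasurable_A_cube[OF A inv p]]
      by (simp add: \<alpha>_def[OF A inv] emeasure_eq_ennreal_measure)
    also have "\<dots> = ennreal (\<kappa> * w m ^ k)" using \<alpha>_proportional[OF A inv ns p] by (simp add: \<kappa>_def)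
    also have "\<dots> = ennreal \<kappa> * emeasure P (cube m p)"
      using k0 by (simp add: emeasure_cube[OF p] ennreal_mult less_imp_le)
    finally show "emeasure N1 (cube m p) = emeasure N2 (cube m p)"
      using cube_sets[OF p] by (simp add: N1 N2)
    show "emeasure N1 (cube m p) \<noteq> \<infinity>"
      using fmeasurableD2[OF fmeasurable_A_cube[OF A inv p]] cube_sets[OF p] by (simp add: N1)
  next
    fix E assume E: "E \<in> null_sets P"
    then have "A \<inter> E \<in> null_sets P" using A by (intro null_set_Int1) auto
    then show "E \<in> null_sets N1 \<and> E \<in> null_sets N2"
      using E by (auto simp: null_sets_def N1 N2 N1_def[THEN arg_cong[of _ _ sets]]
          N2_def[THEN arg_cong[of _ _ sets]])
  qed
  then have eq: "emeasure P (A \<inter> E) = ennreal \<kappa> * emeasure P E" if "E \<in> sets P" for E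
    using N1[OF that] N2[OF that] by simp
  \<comment> \<open>The complement of \<open>A\<close> has no mass under the restriction to
    \<open>A\<close>. If the factor is 0 instead, evaluating at \<open>A\<close> itself shows that
    \<open>A\<close> is null.\<close>
  have "ennreal \<kappa> * emeasure P (space P - A) = 0"
    using eq[of "space P - A"] A by (simp add: sets.compl_sets)
  then consider "\<kappa> = 0" | "emeasure P (space P - A) = 0" using k0 by auto
  then show "emeasure P A = 0 \<or> emeasure P (space P - A) = 0"
    using eq[OF A] by cases auto
qed

section \<open>Convergent series\<close>

text \<open>Excludes exactly the vectors with all coordinates among the last \<open>L + 1\<close>
  subcolumns; a coordinate in the body is what \<open>H_diff_rigid\<close> asks for.\<close>

definition "good_digits m = {i \<in> digits m. \<exists>c<k. i c < b m}"

text \<open>The vectors, in column N + t, of the subcubes of \<open>cube N s\<close> reached through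
  good digits only.\<close>

primrec descendants :: "nat \<Rightarrow> (nat \<Rightarrow> nat) \<Rightarrow> nat \<Rightarrow> (nat \<Rightarrow> nat) set" where
  "descendants N s 0 = {s}"
| "descendants N s (Suc t) =
    (\<lambda>(i, p). child (N + t) i p) ` (good_digits (N + t) \<times> descendants N s t)"

definition "kept N s t = (\<Union>p\<in>descendants N s t. cube (N + t) p)"

lemma valid_descendants: "valid N s \<Longrightarrow> p \<in> descendants N s t \<Longrightarrow> valid (N + t) p"
  by (induction t arbitrary: p) (auto simp: good_digits_def intro!: valid_child)

lemma finite_descendants: "finite (descendants N s t)"
  by (induction t) (auto simp: good_digits_def)

lemma card_descendants: "real (card (descendants N s t)) * w (N + t) ^ k \<le> w N ^ k"
proof (induction t)
  case (Suc t)
  have "card (descendants N s (Suc t)) \<le> card (good_digits (N + t) \<times> descendants N s t)"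
    unfolding descendants.simps
    by (intro card_image_le finite_cartesian_product finite_descendants) (auto simp: good_digits_def)
  also have "\<dots> \<le> R (N + t) ^ k * card (descendants N s t)"
    unfolding card_cartesian_product card_digits[symmetric]
    by (intro mult_right_mono card_mono) (auto simp: good_digits_def)
  finally have "real (card (descendants N s (Suc t))) \<le> real (R (N + t) ^ k * card (descendants N s t))"
    by (rule of_nat_mono)
  then have "real (card (descendants N s (Suc t))) * w (Suc (N + t)) ^ k
     \<le> real (R (N + t) ^ k * card (descendants N s t)) * w (Suc (N + t)) ^ k"
    by (intro mult_right_mono) (auto simp: less_imp_le)
  also have "\<dots> = real (card (descendants N s t)) * w (N + t) ^ k"
    unfolding w_Suc_power[of "N + t", symmetric] by simp
  finally show ?case using Suc by simp
qed simp

lemma kept_fmeasurable: "valid N s \<Longrightarrow> kept N s t \<in> fmeasurable P"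
  unfolding kept_def
  by (intro fmeasurable.finite_UN finite_descendants fmeasurable_cube valid_descendants) auto

lemma kept_decseq: "valid N s \<Longrightarrow> decseq (kept N s)"
proof (rule decseq_SucI, rule subsetI)
  fix t x assume s: "valid N s" and "x \<in> kept N s (Suc t)"
  then obtain i p where ip: "i \<in> good_digits (N + t)" "p \<in> descendants N s t"
      "x \<in> cube (Suc (N + t)) (child (N + t) i p)"
    by (auto simp: kept_def)
  then have "x \<in> cube (N + t) p"
    using cube_Suc[OF valid_descendants[OF s ip(2)]] by (auto simp: good_digits_def)
  then show "x \<in> kept N s t" using ip by (auto simp: kept_def)
qed

text \<open>The bad vectors form a box with side the last \<open>L + 1\<close> subcolumns.\<close>

lemma card_bad_digits: "card (digits m - good_digits m) = (L + 1) ^ k"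
proof -
  have "digits m - good_digits m = PiE {..<k} (\<lambda>_. {b m..<R m})"
  proof (intro equalityI subsetI)
    fix i assume "i \<in> digits m - good_digits m"
    then have i: "i \<in> PiE {..<k} (\<lambda>_. {..<R m})" "\<And>c. c < k \<Longrightarrow> \<not> i c < b m"
      unfolding digits_def good_digits_def by blast+
    then show "i \<in> PiE {..<k} (\<lambda>_. {b m..<R m})"
      by (simp add: PiE_iff not_less)
  next
    fix i assume "i \<in> PiE {..<k} (\<lambda>_. {b m..<R m})"
    then have i: "i \<in> extensional {..<k}" "\<And>c. c < k \<Longrightarrow> b m \<le> i c \<and> i c < R m"
      unfolding PiE_iff by auto
    then have "i \<in> digits m" by (simp add: digits_def PiE_iff)
    moreover have "i \<notin> good_digits m" using i(2) by (auto simp: good_digits_def simp flip: not_less)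
    ultimately show "i \<in> digits m - good_digits m" by blast
  qed
  then show ?thesis by (simp add: card_PiE R_eq)
qed

text \<open>Each remaining cube loses the proportion ((L+1)/R)^k, and the remaining cubes have total
  measure at most that of the initial cube.\<close>

lemma measure_kept_Suc:
  assumes "valid N s"
  shows "measure P (kept N s t) \<le>
    measure P (kept N s (Suc t)) + (real (L + 1) * (1 / real (R (N + t)))) ^ k * w N ^ k"
proof -
  let ?m = "N + t" and ?D = "descendants N s t"
  let ?B = "digits ?m - good_digits ?m"
  let ?bad = "\<Union>p\<in>?D. \<Union>i\<in>?B. cube (Suc ?m) (child ?m i p)"
  have vc: "valid (Suc ?m) (child ?m i p)" if "p \<in> ?D" "i \<in> ?B" for i p
    using valid_child valid_descendants[OF assms] that by auto
  have bad: "?bad \<in> fmeasurable P"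
    using vc by (intro fmeasurable.finite_UN finite_descendants fmeasurable_cube) auto
  have "kept N s t \<subseteq> kept N s (Suc t) \<union> ?bad"
  proof
    fix x assume "x \<in> kept N s t"
    then obtain p where p: "p \<in> ?D" "x \<in> cube ?m p" by (auto simp: kept_def)
    then obtain i where i: "i \<in> digits ?m" "x \<in> cube (Suc ?m) (child ?m i p)"
      using cube_Suc[OF valid_descendants[OF assms p(1)]] by blast
    show "x \<in> kept N s (Suc t) \<union> ?bad"
    proof (cases "i \<in> good_digits ?m")
      case True
      then have "child ?m i p \<in> descendants N s (Suc t)" using p by auto
      then have "x \<in> kept N s (Suc t)" using i(2) unfolding kept_def add_Suc_right by blast
      then show ?thesis by blast
    qed (use i p in blast)
  qed
  then have "measure P (kept N s t) \<le> measure P (kept N s (Suc t) \<union> ?bad)"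
    using kept_fmeasurable[OF assms] bad
    by (intro measure_mono_fmeasurable fmeasurable.Un) auto
  also have "\<dots> \<le> measure P (kept N s (Suc t)) + measure P ?bad"
    using kept_fmeasurable[OF assms] bad by (intro measure_Un_le) auto
  also have "measure P ?bad \<le> (\<Sum>p\<in>?D. measure P (\<Union>i\<in>?B. cube (Suc ?m) (child ?m i p)))"
    using vc by (intro measure_UNION_le finite_descendants sets.finite_UN cube_sets) auto
  also have "\<dots> \<le> (\<Sum>p\<in>?D. \<Sum>i\<in>?B. measure P (cube (Suc ?m) (child ?m i p)))"
    using vc by (intro sum_mono measure_UNION_le cube_sets) auto
  also have "\<dots> = (\<Sum>p\<in>?D. \<Sum>i\<in>?B. w (Suc ?m) ^ k)"
    using vc by (intro sum.cong refl) (simp add: measure_def emeasure_cube less_imp_le)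
  also have "\<dots> = real (card ?D) * (real (L + 1) ^ k * w (Suc ?m) ^ k)"
    by (simp add: card_bad_digits)
  also have "\<dots> = (real (L + 1) * (1 / real (R ?m))) ^ k * (real (card ?D) * w ?m ^ k)"
    by (simp add: w_Suc power_divide)
  also have "\<dots> \<le> (real (L + 1) * (1 / real (R ?m))) ^ k * w N ^ k"
    by (intro mult_left_mono card_descendants) auto
  finally show ?thesis by simp
qed

lemma measure_kept_ge:
  assumes "valid N s"
  shows "w N ^ k * (1 - (\<Sum>j<t. (real (L + 1) * (1 / real (R (j + N)))) ^ k)) \<le> measure P (kept N s t)"
proof (induction t)
  case 0
  then show ?case using assms by (simp add: kept_def measure_def emeasure_cube less_imp_le)
next
  case (Suc t)
  then show ?case using measure_kept_Suc[OF assms, of t] by (simp add: algebra_simps)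
qed

text \<open>At least half of the initial cube survives every step, and continuity from above carries
  this to the limit.\<close>

lemma kept_Inter_pos:
  assumes s: "valid N s" and "\<And>t. (\<Sum>j<t. (real (L + 1) * (1 / real (R (j + N)))) ^ k) \<le> 1/2"
  shows "0 < emeasure P (\<Inter>t. kept N s t)" "(\<Inter>t. kept N s t) \<in> sets P"
proof -
  have "ennreal (w N ^ k / 2) \<le> emeasure P (kept N s t)" for t
  proof -
    have "w N ^ k * (1/2) \<le> w N ^ k * (1 - (\<Sum>j<t. (real (L + 1) * (1 / real (R (j + N)))) ^ k))"
      using assms(2)[of t] by (intro mult_left_mono) (auto simp: less_imp_le)
    then have "w N ^ k / 2 \<le> measure P (kept N s t)" using measure_kept_ge[OF s, of t] by linarith
    moreover have "emeasure P (kept N s t) = ennreal (measure P (kept N s t))"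
      using fmeasurableD2[OF kept_fmeasurable[OF s]] by (intro emeasure_eq_ennreal_measure) simp
    ultimately show ?thesis by (simp add: ennreal_leI)
  qed
  then have "ennreal (w N ^ k / 2) \<le> (INF t. emeasure P (kept N s t))" by (intro INF_greatest)
  also have "\<dots> = emeasure P (\<Inter>t. kept N s t)"
    using kept_fmeasurable[OF s] kept_decseq[OF s] fmeasurableD2[OF kept_fmeasurable[OF s]]
    by (intro INF_emeasure_decseq) auto
  finally have "ennreal (w N ^ k / 2) \<le> emeasure P (\<Inter>t. kept N s t)" .
  moreover have "0 < ennreal (w N ^ k / 2)" by simp
  ultimately show "0 < emeasure P (\<Inter>t. kept N s t)" by (rule less_le_trans[rotated])
  show "(\<Inter>t. kept N s t) \<in> sets P" using kept_fmeasurable[OF s] by (intro sets.countable_INT) auto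
qed

text \<open>If the vectors after a step differed by a constant, the height differences chosen in any
  two coordinates would be less than 2h apart, since earlier levels are below h. Rigidity makes them
  equal, so the vectors before the step would differ by a constant too.\<close>

lemma descendants_not_aligned:
  assumes s: "valid N s" "valid N s'" and ne: "\<And>z. \<exists>c<k. int (s' c) - int (s c) \<noteq> z"
    and "p \<in> descendants N s t" "p' \<in> descendants N s' t"
  shows "\<exists>c<k. int (p' c) - int (p c) \<noteq> z"
  using assms(4,5)
proof (induction t arbitrary: p p' z)
  case 0
  then show ?case using ne by simp
next
  case (Suc t)
  let ?m = "N + t"
  obtain i q where i: "i \<in> good_digits ?m" "q \<in> descendants N s t" "p = child ?m i q"
    using Suc.prems(1) by auto
  obtain i' q' where i': "i' \<in> good_digits ?m" "q' \<in> descendants N s' t" "p' = child ?m i' q'"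
    using Suc.prems(2) by auto
  obtain c0 where c0: "c0 < k" "i c0 < b ?m" using i(1) by (auto simp: good_digits_def)
  have q: "q c < h ?m" "q' c < h ?m" if "c < k" for c
    using valid_descendants[OF s(1) i(2)] valid_descendants[OF s(2) i'(2)] that by (auto simp: valid_def)
  have d: "i c < R ?m" "i' c < R ?m" if "c < k" for c
    using i(1) i'(1) that by (auto simp: good_digits_def digits_def PiE_iff)
  define \<delta> where "\<delta> c = int (H ?m (i' c)) - int (H ?m (i c))" for c
  show ?case
  proof (rule ccontr)
    assume "\<not> ?thesis"
    then have z: "\<delta> c + (int (q' c) - int (q c)) = z" if "c < k" for c
      using that i(3) i'(3) by (auto simp: \<delta>_def child_def)
    \<comment> \<open>The coordinate \<open>c0\<close> in the body is compared with every other one;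
      a single good coordinate on one side suffices.\<close>
    have "\<delta> c0 = \<delta> c" if "c < k" for c
      unfolding \<delta>_def
    proof (rule H_diff_rigid[OF c0(2) d(2)[OF c0(1)] d[OF that]])
      have "\<bar>\<delta> c0 - \<delta> c\<bar> < 2 * int (h ?m)"
        using z[OF c0(1)] z[OF that] q[OF c0(1)] q[OF that] by linarith
      then show "\<bar>int (H ?m (i' c0)) - int (H ?m (i c0)) - (int (H ?m (i' c)) - int (H ?m (i c)))\<bar>
          < 2 * int (h ?m)" by (simp add: \<delta>_def)
    qed
    then have "int (q' c) - int (q c) = z - \<delta> c0" if "c < k" for c using z[OF that] that by simp
    then show False using Suc.IH[OF i(2) i'(2), of "z - \<delta> c0"] by blast
  qed
qed

section \<open>An invariant set separating two cubes\<close>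

text \<open>Common translates of the descendants: the cubes that an orbit through them can meet
  inside column N + t.\<close>

definition "aligned N s t = {q. valid (N + t) q \<and> (\<exists>p\<in>descendants N s t. \<exists>z. \<forall>c<k. int (q c) = int (p c) + z)}"

definition "orbit_tube N s t = (\<Union>q\<in>aligned N s t. cube (N + t) q)"

text \<open>Membership is only required eventually, because column N + t describes the motion of
  \<open>x\<close> only once no coordinate of \<open>x\<close> is in its top level.\<close>

definition "orbit_set N s = {x \<in> space P. \<exists>t0. \<forall>t\<ge>t0. x \<in> orbit_tube N s t}"

lemma orbit_tube_sets: "orbit_tube N s t \<in> sets P"
proof -
  \<comment> \<open>The index set \<open>aligned\<close> may be uncountable, its vectors being
    arbitrary from \<open>k\<close> on; the set of cubes it indexes is countable.\<close>
  have "orbit_tube N s t = \<Union>{a \<in> cubes. \<exists>q\<in>aligned N s t. a = cube (N + t) q}"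
    unfolding orbit_tube_def cubes_def aligned_def by blast
  moreover have "\<dots> \<in> sets P"
    using cubes_sets countable_cubes
    by (intro sets.countable_Union) (auto intro: countable_subset[OF _ countable_cubes])
  ultimately show ?thesis by simp
qed

lemma orbit_set_sets: "orbit_set N s \<in> sets P"
proof -
  have "orbit_set N s = space P \<inter> (\<Union>t0. \<Inter>t\<in>{t0..}. orbit_tube N s t)"
    by (auto simp: orbit_set_def)
  moreover have "(\<Union>t0. \<Inter>t\<in>{t0..}. orbit_tube N s t) \<in> sets P"
    using orbit_tube_sets by (intro sets.countable_UN' sets.countable_INT') auto
  ultimately show ?thesis by auto
qed

text \<open>Below the top of the column \<open>Tk\<close> adds 1 to every entry, which only changes
  the constant \<open>z\<close> in \<open>aligned\<close>.\<close>

lemma orbit_tube_Tk: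
  assumes p: "valid (N + t) (\<lambda>c. Suc (p c))" "x \<in> cube (N + t) p"
  shows "Tk x \<in> orbit_tube N s t \<longleftrightarrow> x \<in> orbit_tube N s t"
proof -
  let ?m = "N + t"
  have vp: "valid ?m p" using p(1) by (auto simp: valid_def dest: Suc_lessD)
  have Tx: "Tk x \<in> cube ?m (\<lambda>c. Suc (p c))" using Tk_vimage_cube[OF p(1)] p(2) by blast
  have iff: "y \<in> orbit_tube N s t \<longleftrightarrow> q \<in> aligned N s t" if "valid ?m q" "y \<in> cube ?m q" for y q
  proof
    assume "y \<in> orbit_tube N s t"
    then obtain q' where q': "q' \<in> aligned N s t" "y \<in> cube ?m q'" by (auto simp: orbit_tube_def)
    then have "q c = q' c" if "c < k" for c
      using cube_disjoint[OF \<open>y \<in> cube ?m q\<close> q'(2)] \<open>valid ?m q\<close> that by (auto simp: aligned_def)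
    then show "q \<in> aligned N s t" using q'(1) \<open>valid ?m q\<close> by (auto simp: aligned_def)
  qed (use that in \<open>auto simp: orbit_tube_def\<close>)
  have "(\<lambda>c. Suc (p c)) \<in> aligned N s t \<longleftrightarrow> p \<in> aligned N s t"
  proof
    assume "(\<lambda>c. Suc (p c)) \<in> aligned N s t"
    then obtain q z where q: "q \<in> descendants N s t" "\<forall>c<k. int (Suc (p c)) = int (q c) + z"
      unfolding aligned_def by blast
    then have "\<forall>c<k. int (p c) = int (q c) + (z - 1)" by auto
    then show "p \<in> aligned N s t" using q vp unfolding aligned_def by blast
  next
    assume "p \<in> aligned N s t"
    then obtain q z where q: "q \<in> descendants N s t" "\<forall>c<k. int (p c) = int (q c) + z"
      unfolding aligned_def by blast
    then have "\<forall>c<k. int (Suc (p c)) = int (q c) + (z + 1)" by auto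
    then show "(\<lambda>c. Suc (p c)) \<in> aligned N s t" using q p(1) unfolding aligned_def by blast
  qed
  then show ?thesis using iff[OF p(1) Tx] iff[OF vp p(2)] by simp
qed

lemma orbit_set_invariant: "Tk -` orbit_set N s \<inter> space P = orbit_set N s"
proof -
  have "Tk x \<in> orbit_set N s \<longleftrightarrow> x \<in> orbit_set N s" if x: "x \<in> space P" for x
  proof -
    obtain n where n: "\<And>m. n \<le> m \<Longrightarrow> \<exists>p. valid m (\<lambda>c. Suc (p c)) \<and> x \<in> cube m p"
      using ex_cube[OF x] by blast
    have iff: "Tk x \<in> orbit_tube N s t \<longleftrightarrow> x \<in> orbit_tube N s t" if "n \<le> t" for t
      using n[of "N + t"] orbit_tube_Tk that by auto
    have "(\<exists>t0. \<forall>t\<ge>t0. Tk x \<in> orbit_tube N s t) \<longleftrightarrow> (\<exists>t0. \<forall>t\<ge>t0. x \<in> orbit_tube N s t)"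
    proof
      assume "\<exists>t0. \<forall>t\<ge>t0. Tk x \<in> orbit_tube N s t"
      then obtain t0 where "\<forall>t\<ge>t0. Tk x \<in> orbit_tube N s t" by blast
      then have "\<forall>t\<ge>max n t0. x \<in> orbit_tube N s t"
        using iff by (meson max.boundedE)
      then show "\<exists>t0. \<forall>t\<ge>t0. x \<in> orbit_tube N s t" by blast
    next
      assume "\<exists>t0. \<forall>t\<ge>t0. x \<in> orbit_tube N s t"
      then obtain t0 where "\<forall>t\<ge>t0. x \<in> orbit_tube N s t" by blast
      then have "\<forall>t\<ge>max n t0. Tk x \<in> orbit_tube N s t"
        using iff by (meson max.boundedE)
      then show "\<exists>t0. \<forall>t\<ge>t0. Tk x \<in> orbit_tube N s t" by blast
    qed
    moreover have "Tk x \<in> space P" using measurable_space[OF Tk_measurable x] .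
    ultimately show ?thesis using x by (simp add: orbit_set_def)
  qed
  moreover have "orbit_set N s \<subseteq> space P" by (auto simp: orbit_set_def)
  ultimately show ?thesis by blast
qed

theorem not_ergodic_if_summable:
  assumes "summable (\<lambda>i. (1 / real (R i)) ^ k)"
  shows "\<not> ergodic P Tk"
proof
  assume erg: "ergodic P Tk"
  \<comment> \<open>The proportion lost in column \<open>j\<close>; the starting column
    \<open>N\<close> is taken so late that the total loss is at most one half.\<close>
  define a where "a j = (real (L + 1) * (1 / real (R j))) ^ k" for j
  have a: "summable a" "\<And>j. 0 \<le> a j"
    using summable_mult[OF assms, of "real (L + 1) ^ k"] by (auto simp: a_def[abs_def] power_mult_distrib power_divide)
  obtain N0 where N0: "\<forall>n\<ge>N0. norm (\<Sum>i. a (i + n)) < 1/2"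
    using suminf_exist_split[OF _ a(1), of "1/2"] by auto
  \<comment> \<open>The successor ensures a height of at least 2, so that level 1 exists for the
    vector \<open>?s'\<close>.\<close>
  define N where "N = Suc N0"
  have sum_le: "(\<Sum>j<t. a (j + N)) \<le> 1/2" for t
  proof -
    have "(\<Sum>j<t. a (j + N)) \<le> (\<Sum>j. a (j + N))"
      using a by (intro sum_le_suminf) (auto simp: summable_iff_shift)
    also have "\<dots> \<le> 1/2" using N0[rule_format, of N] by (auto simp: N_def)
    finally show ?thesis .
  qed
  have hN: "2 \<le> h N" using h_pos[of N] by (simp add: N_def h_Suc)
  \<comment> \<open>As \<open>k\<close> is at least 2, changing coordinate 0 alone yields vectors
    whose difference is not constant.\<close>
  let ?s = "\<lambda>c::nat. 0::nat" and ?s' = "\<lambda>c::nat. if c = 0 then 1 else 0 :: nat"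
  have s: "valid N ?s" "valid N ?s'" using hN by (auto simp: valid_def)
  have ne: "\<exists>c<k. int (?s' c) - int (?s c) \<noteq> z" for z
    using k_gt_1 by (cases "z = 0") (auto intro: exI[of _ 0] exI[of _ 1])
  define W where "W = (\<Inter>t. kept N ?s t)"
  define W' where "W' = (\<Inter>t. kept N ?s' t)"
  have W: "0 < emeasure P W" "0 < emeasure P W'" "W \<in> sets P" "W' \<in> sets P"
    unfolding W_def W'_def using kept_Inter_pos s sum_le unfolding a_def by blast+
  have "W \<subseteq> orbit_set N ?s"
  proof
    fix x assume x: "x \<in> W"
    have "x \<in> orbit_tube N ?s t" for t
    proof -
      obtain p where p: "p \<in> descendants N ?s t" "x \<in> cube (N + t) p"
        using x unfolding W_def kept_def by blast
      then have "p \<in> aligned N ?s t"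
        using valid_descendants[OF s(1)] by (auto simp: aligned_def intro!: bexI[of _ p] exI[of _ 0])
      then show ?thesis using p by (auto simp: orbit_tube_def)
    qed
    moreover have "x \<in> space P" using sets.sets_into_space[OF W(3)] x by blast
    ultimately show "x \<in> orbit_set N ?s" by (simp add: orbit_set_def)
  qed
  moreover have "W' \<subseteq> space P - orbit_set N ?s"
  proof
    fix x assume x: "x \<in> W'"
    \<comment> \<open>Otherwise the kept cube of \<open>?s'\<close> containing \<open>x\<close>
      would be a common translate of a descendant of \<open>?s\<close>. This fails for all
      \<open>t\<close>, hence also eventually.\<close>
    have "x \<notin> orbit_tube N ?s t" for t
    proof
      assume "x \<in> orbit_tube N ?s t"
      then obtain q p z where q: "valid (N + t) q" "x \<in> cube (N + t) q" "p \<in> descendants N ?s t"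
         "\<forall>c<k. int (q c) = int (p c) + z"
        unfolding orbit_tube_def aligned_def by blast
      obtain p' where p': "p' \<in> descendants N ?s' t" "x \<in> cube (N + t) p'"
        using x unfolding W'_def kept_def by blast
      have "q c = p' c" if "c < k" for c
        using cube_disjoint[OF q(2) p'(2) q(1) valid_descendants[OF s(2) p'(1)] that] .
      then have "\<forall>c<k. int (p' c) - int (p c) = z" using q(4) by auto
      then show False using descendants_not_aligned[OF s ne q(3) p'(1), of z] by blast
    qed
    moreover have "x \<in> space P" using sets.sets_into_space[OF W(4)] x by blast
    ultimately show "x \<in> space P - orbit_set N ?s" by (auto simp: orbit_set_def)
  qed
  ultimately have "0 < emeasure P (orbit_set N ?s)" "0 < emeasure P (space P - orbit_set N ?s)"
    using W orbit_set_sets[of N ?s] by (meson emeasure_mono less_le_trans sets.compl_sets)+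
  then show False
    using erg orbit_set_sets[of N ?s] orbit_set_invariant[of N ?s] unfolding ergodic_def by auto
qed

end

theorem mainTheorem8:
  fixes k L :: nat and r :: "nat \<Rightarrow> nat" and v :: "nat \<Rightarrow> nat list"
  assumes "1 < k" and "k \<le> L"
    and "bij_betw v {1..} (VL L)"
    and "\<forall>n\<ge>1. r n \<le> r (Suc n)"
    and "\<forall>n\<ge>1. L < r n"
  shows "ergodic (PiM {..<k} (\<lambda>_. rk_measure r v)) (prod_map k (rk_map r v))
     \<longleftrightarrow> \<not> summable (\<lambda>i. (1 / real (r (Suc i))) ^ k)"
proof -
  interpret rank_one_tower k L r v
    using assms by unfold_locales
  show ?thesis
    using ergodic_if_not_summable not_ergodic_if_summable unfolding R_def by blast
qed

end
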